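(* For every $\epsilon>0$, \texttt{CleverMaker} has a strategy in the $(1:(1-\epsilon)n)$ half-random perfect matching game on $E(K_n)$ against \texttt{RandomBreaker} which, asymptotically almost surely (i.e. with probability tending to $1$ as $n\to\infty$), is winning within $\frac{n}{2}+O(\log n)$ moves of \texttt{CleverMaker}. In particular, the sharp threshold bias for both the $(1:b)$ half-random perfect matching game and the $(1:b)$ half-random minimum-degree-$1$ game between \texttt{CleverMaker} and \texttt{RandomBreaker} is $n$.
   Context: Maker-Breaker games on the board $E(K_n)$: two players alternately claim previously unclaimed (free) edges of the complete graph $K_n$; in a $(1:b)$-biased game Maker claims $1$ edge per turn and Breaker claims $b$ edges per turn, Maker moves first. Maker wins if his graph contains a member of the winning family, otherwise Breaker wins. The perfect matching game: Maker wins if his graph contains a perfect matching of $K_n$. The minimum-degree-$1$ game: Maker wins if his graph has minimum degree at least $1$ on all $n$ vertices. In the half-random game between \texttt{CleverMaker} and \texttt{RandomBreaker}, Breaker (\texttt{RandomBreaker}) claims in each of her moves an edge chosen uniformly at random among all currently free edges, while Maker (\texttt{CleverMaker}) follows a (deterministic) strategy of his choice. A function $k:\mathbb{N}_0\to\mathbb{N}_0$ is a sharp threshold bias of the $(1:b)$ half-random game if for every $\epsilon>0$: (a) \texttt{RandomBreaker} wins the $(1:(1+\epsilon)k(n))$ game with probability tending to $1$ against any strategy of \texttt{CleverMaker}, and (b) \texttt{CleverMaker} has a strategy against which \texttt{RandomBreaker} loses the $(1:(1-\epsilon)k(n))$ game with probability tending to $1$. Games and strategies are understood as sequences indexed by $n$;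 biases are rounded to integers.
   Formalization: For the perfect matching game the limits (fast win and sharp threshold) are taken along even n only, since K_n has no perfect matching for odd n; the minimum-degree-1 claim is for all n. *)

theory Defs
  imports "HOL-Probability.Probability" "HOL-Library.Landau_Symbols"
begin

type_synonym edge = "nat set"

definition board :: "nat \<Rightarrow> edge set" where
  "board n = {e. e \<subseteq> {..<n} \<and> card e = 2}"

text \<open>
  A history consists of the edges claimed by Maker and the edges claimed by Breaker, each in
  chronological order. Since the bias is fixed and Maker starts, the interleaving of the two
  lists carries no further information.
\<close>
type_synonym history = "edge list \<times> edge list"

type_synonym strategy = "history \<Rightarrow> edge"

definition free_edges :: "nat \<Rightarrow> history \<Rightarrow> edge set" where
  "free_edges n h = board n - (set (fst h) \<union> set (snd h))"

definition legal_strategy :: "nat \<Rightarrow> strategy \<Rightarrow> bool" where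
  "legal_strategy n S \<longleftrightarrow> (\<forall>h. free_edges n h \<noteq> {} \<longrightarrow> S h \<in> free_edges n h)"

definition maker_turn :: "nat \<Rightarrow> strategy \<Rightarrow> history \<Rightarrow> history" where
  "maker_turn n S h = (if free_edges n h = {} then h else (fst h @ [S h], snd h))"

text \<open>If fewer than \<open>b\<close> edges are free, RandomBreaker claims all of them.\<close>
primrec random_breaker_turn :: "nat \<Rightarrow> nat \<Rightarrow> history \<Rightarrow> history pmf" where
  "random_breaker_turn n 0 h = return_pmf h"
| "random_breaker_turn n (Suc b) h =
     (if free_edges n h = {} then return_pmf h
      else bind_pmf (pmf_of_set (free_edges n h))
             (\<lambda>e. random_breaker_turn n b (fst h, snd h @ [e])))"

text \<open>
  The history after \<open>t\<close> rounds, a round being a turn of Maker followed by a turn of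
  Breaker. Maker's graph after \<open>t\<close> rounds is his graph right after his \<open>t\<close>-th move.
\<close>
primrec half_random_play :: "nat \<Rightarrow> nat \<Rightarrow> strategy \<Rightarrow> nat \<Rightarrow> history pmf" where
  "half_random_play n b S 0 = return_pmf ([], [])"
| "half_random_play n b S (Suc t) =
     bind_pmf (half_random_play n b S t) (\<lambda>h. random_breaker_turn n b (maker_turn n S h))"

text \<open>
  Every round uses up at least one free edge as long as there is one, so
  \<^term>\<open>card (board n)\<close> rounds exhaust the board.
\<close>
definition half_random_game :: "nat \<Rightarrow> nat \<Rightarrow> strategy \<Rightarrow> history pmf" where
  "half_random_game n b S = half_random_play n b S (card (board n))"

definition maker_wins :: "edge set set \<Rightarrow> history \<Rightarrow> bool" where
  "maker_wins F h \<longleftrightarrow> (\<exists>W\<in>F. W \<subseteq> set (fst h))"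

definition perfect_matchings :: "nat \<Rightarrow> edge set set" where
  "perfect_matchings n = {M. M \<subseteq> board n \<and> (\<forall>v<n. \<exists>!e. e \<in> M \<and> v \<in> e)}"

definition vertex_degree :: "edge set \<Rightarrow> nat \<Rightarrow> nat" where
  "vertex_degree G v = card {e \<in> G. v \<in> e}"

definition min_degree_one_graphs :: "nat \<Rightarrow> edge set set" where
  "min_degree_one_graphs n = {G. G \<subseteq> board n \<and> (\<forall>v<n. vertex_degree G v \<ge> 1)}"

text \<open>A negative real bias is rounded to \<open>0\<close>.\<close>
definition int_bias :: "real \<Rightarrow> nat" where
  "int_bias x = nat \<lfloor>x\<rfloor>"

text \<open>
  The filter \<open>A\<close> says along which \<open>n\<close> the limits are taken: \<^term>\<open>sequentially\<close> for all
  \<open>n\<close>, or its restriction to the \<open>n\<close> for which the winning family is nonempty.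
\<close>
definition sharp_threshold_bias ::
    "nat filter \<Rightarrow> (nat \<Rightarrow> edge set set) \<Rightarrow> (nat \<Rightarrow> nat) \<Rightarrow> bool" where
  "sharp_threshold_bias A F k \<longleftrightarrow>
     (\<forall>\<epsilon>>0.
        (\<forall>S. (\<forall>n. legal_strategy n (S n)) \<longrightarrow>
           ((\<lambda>n. measure_pmf.prob
                    (half_random_game n (int_bias ((1 + \<epsilon>) * real (k n))) (S n))
                    {h. \<not> maker_wins (F n) h}) \<longlongrightarrow> 1) A) \<and>
        (\<exists>S. (\<forall>n. legal_strategy n (S n)) \<and>
           ((\<lambda>n. measure_pmf.prob
                    (half_random_game n (int_bias ((1 - \<epsilon>) * real (k n))) (S n))
                    {h. maker_wins (F n) h}) \<longlongrightarrow> 1) A))"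

text \<open>\<open>K\<^sub>n\<close> has a perfect matching only for even \<open>n\<close>.\<close>
definition even_sequentially :: "nat filter" where
  "even_sequentially = inf sequentially (principal {n. even n})"

end

theory Submission
  imports Defs "HOL-Real_Asymp.Real_Asymp"
begin

text \<open>
  With bias \<open>(1 + \<epsilon>) n\<close> the board is exhausted before Maker has claimed \<open>n / 2\<close> edges, so some vertex
  stays isolated whatever Breaker does.

  With bias \<open>(1 - \<epsilon>) n\<close> a constant proportion of the edges is still free after
  \<open>n / 2 + O(log n)\<close> rounds, and a fixed set of \<open>s\<close> edges is entirely Breaker's with probability
  at most \<open>(1 - \<delta>)\<^sup>s\<close>: if \<open>f\<close> edges are free now and \<open>m\<close> at the end, then \<open>(1 - m / f)\<^sup>j\<close> with \<open>j\<close>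
  the number of free edges of the set is a supermartingale as long as Maker stays away from the
  set. By a union bound, a.a.s. Breaker owns neither all edges between two disjoint sets of
  \<open>k = O(log n)\<close> vertices nor almost all edges at a vertex. Hence Maker can greedily match all but
  \<open>2 k\<close> vertices without wasting a move. He matches the remaining ones in pairs along augmenting
  paths with three new edges: if \<open>A\<close> and \<open>B\<close> are the sets of partners of the free neighbours of
  \<open>u\<close> and of \<open>v\<close>, there is a free edge between \<open>A\<close> and \<open>B\<close>. Maker claims it first, and the two
  edges at \<open>u\<close> and \<open>v\<close> survive the next two turns of Breaker with probability \<open>1 - O(1 / n)\<close>. For the
  minimum degree game it suffices to claim any free edge at each of the remaining vertices.
\<close>

section \<open>Free edges and the course of the game\<close>

lemma finite_board [simp]: "finite (board n)"
proof -
  have "board n \<subseteq> Pow {..<n}" by (auto simp: board_def)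
  thus ?thesis by (rule finite_subset) simp
qed

lemma card_board: "card (board n) = n * (n - 1) div 2"
  using n_subsets[of "{..<n}" 2] by (simp add: board_def choose_two)

lemma doubleton_in_board: "u < n \<Longrightarrow> v < n \<Longrightarrow> u \<noteq> v \<Longrightarrow> {u, v} \<in> board n"
  by (simp add: board_def)

lemma finite_free_edges [simp]: "finite (free_edges n h)"
  by (simp add: free_edges_def)

lemma free_edges_breaker:
  "free_edges n (fst h, snd h @ [e]) = free_edges n h - {e}"
  by (auto simp: free_edges_def)

lemma free_edges_maker:
  "free_edges n (fst h @ [e], snd h) = free_edges n h - {e}"
  by (auto simp: free_edges_def)

lemma random_breaker_turn_support:
  assumes "h' \<in> set_pmf (random_breaker_turn n b h)"
  shows "fst h' = fst h" "set (snd h) \<subseteq> set (snd h')"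
    "card (free_edges n h') = card (free_edges n h) - b"
proof -
  have "fst h' = fst h \<and> set (snd h) \<subseteq> set (snd h') \<and>
    card (free_edges n h') = card (free_edges n h) - b"
    using assms
  proof (induction b arbitrary: h)
    case 0
    then show ?case by simp
  next
    case (Suc b)
    show ?case
    proof (cases "free_edges n h = {}")
      case True
      with Suc.prems show ?thesis by simp
    next
      case False
      with Suc.prems obtain e where e: "e \<in> free_edges n h"
        "h' \<in> set_pmf (random_breaker_turn n b (fst h, snd h @ [e]))"
        by (auto simp: set_pmf_of_set)
      from Suc.IH[OF e(2)] e(1) show ?thesis
        by (simp add: free_edges_breaker card_Diff_singleton)
    qed
  qed
  thus "fst h' = fst h" "set (snd h) \<subseteq> set (snd h')"
    "card (free_edges n h') = card (free_edges n h) - b" by auto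
qed

lemma maker_turn_legal:
  assumes "legal_strategy n S" "free_edges n h \<noteq> {}"
  shows "S h \<in> free_edges n h" "maker_turn n S h = (fst h @ [S h], snd h)"
  using assms unfolding legal_strategy_def maker_turn_def by (blast, simp)

lemma card_free_maker_turn:
  assumes "legal_strategy n S"
  shows "card (free_edges n (maker_turn n S h)) = card (free_edges n h) - 1"
proof (cases "free_edges n h = {}")
  case True
  then show ?thesis by (simp add: maker_turn_def)
next
  case False
  with maker_turn_legal[OF assms False] show ?thesis
    by (simp add: free_edges_maker card_Diff_singleton)
qed

text \<open>Chance decides which edges Breaker gets, not how many: the number of free edges depends
  on the round alone. Truncated subtraction covers an exhausted board.\<close>

lemma card_free_play:
  assumes "legal_strategy n S" "h \<in> set_pmf (half_random_play n b S t)"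
  shows "card (free_edges n h) = card (board n) - t * (b + 1)"
  using assms(2)
proof (induction t arbitrary: h)
  case 0
  then show ?case by (simp add: free_edges_def)
next
  case (Suc t)
  then obtain h0 where h0: "h0 \<in> set_pmf (half_random_play n b S t)"
    "h \<in> set_pmf (random_breaker_turn n b (maker_turn n S h0))" by auto
  show ?case
    using Suc.IH[OF h0(1)] random_breaker_turn_support(3)[OF h0(2)]
    by (simp add: card_free_maker_turn[OF assms(1)])
qed

lemma maker_turn_mono: "set (fst h) \<subseteq> set (fst (maker_turn n S h))"
  by (auto simp: maker_turn_def)

lemma snd_maker_turn [simp]: "snd (maker_turn n S h) = snd h"
  by (simp add: maker_turn_def)

section \<open>Probabilities of events after one more random step\<close>

lemma prob_bind_ge:
  fixes M :: "'a pmf" and f :: "'a \<Rightarrow> 'b pmf"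
  assumes "\<And>x y. x \<in> A \<Longrightarrow> y \<in> set_pmf (f x) \<Longrightarrow> y \<in> B"
  shows "measure_pmf.prob M A \<le> measure_pmf.prob (bind_pmf M f) B"
proof -
  have "emeasure (measure_pmf M) A = (\<integral>\<^sup>+x. indicator A x \<partial>measure_pmf M)" by simp
  also have "\<dots> \<le> (\<integral>\<^sup>+x. emeasure (measure_pmf (f x)) B \<partial>measure_pmf M)"
  proof (rule nn_integral_mono)
    fix x
    show "indicator A x \<le> emeasure (measure_pmf (f x)) B"
    proof (cases "x \<in> A")
      case True
      then have "AE y in measure_pmf (f x). y \<in> B" using assms by (auto simp: AE_measure_pmf_iff)
      then have "measure_pmf.prob (f x) B = 1"
        by (subst measure_pmf.prob_eq_1) auto
      then show ?thesis by (simp add: measure_pmf.emeasure_eq_measure indicator_def)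
    qed simp
  qed
  also have "\<dots> = emeasure (measure_pmf (bind_pmf M f)) B" by (simp add: emeasure_bind_pmf)
  finally show ?thesis by (simp add: measure_pmf.emeasure_eq_measure)
qed

text \<open>Either the position already lies in the exceptional set \<open>A\<close>, or the next
  step fails with conditional probability at most \<open>c\<close>.\<close>

lemma prob_bind_le:
  fixes M :: "'a pmf" and f :: "'a \<Rightarrow> 'b pmf"
  assumes "\<And>x. x \<in> set_pmf M \<Longrightarrow> x \<notin> A \<Longrightarrow> measure_pmf.prob (f x) B \<le> c" and "c \<ge> 0"
  shows "measure_pmf.prob (bind_pmf M f) B \<le> measure_pmf.prob M A + c"
proof -
  have "emeasure (measure_pmf (bind_pmf M f)) B =
      (\<integral>\<^sup>+x. emeasure (measure_pmf (f x)) B \<partial>measure_pmf M)" by (simp add: emeasure_bind_pmf)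
  also have "\<dots> \<le> (\<integral>\<^sup>+x. indicator A x + ennreal c \<partial>measure_pmf M)"
  proof (rule nn_integral_mono_AE, unfold AE_measure_pmf_iff, intro ballI)
    fix x assume x: "x \<in> set_pmf M"
    show "emeasure (measure_pmf (f x)) B \<le> indicator A x + ennreal c"
    proof (cases "x \<in> A")
      case True
      have "emeasure (measure_pmf (f x)) B \<le> 1" by (rule measure_pmf.emeasure_le_1)
      also have "\<dots> \<le> indicator A x + ennreal c" using True by simp
      finally show ?thesis .
    next
      case False
      with assms(1)[OF x False] show ?thesis
        by (simp add: measure_pmf.emeasure_eq_measure ennreal_leI)
    qed
  qed
  also have "\<dots> = emeasure (measure_pmf M) A + ennreal c"
    by (subst nn_integral_add) auto
  also have "\<dots> = ennreal (measure_pmf.prob M A + c)"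
    using assms(2) by (simp add: measure_pmf.emeasure_eq_measure ennreal_plus)
  finally show ?thesis
    using assms(2) by (simp add: measure_pmf.emeasure_eq_measure del: ennreal_plus)
qed

lemma prob_play_mono:
  assumes "\<And>h h'. h \<in> A \<Longrightarrow> set (fst h) \<subseteq> set (fst h') \<Longrightarrow> h' \<in> A" and "s \<le> t"
  shows "measure_pmf.prob (half_random_play n b S s) A
    \<le> measure_pmf.prob (half_random_play n b S t) A"
  using assms(2)
proof (induction t rule: dec_induct)
  case (step t)
  have "measure_pmf.prob (half_random_play n b S t) A
      \<le> measure_pmf.prob (half_random_play n b S (Suc t)) A"
    unfolding half_random_play.simps
  proof (rule prob_bind_ge)
    fix h h' assume "h \<in> A" and h': "h' \<in> set_pmf (random_breaker_turn n b (maker_turn n S h))"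
    then show "h' \<in> A"
      using assms(1)[of h h'] maker_turn_mono[of h n S] random_breaker_turn_support(1)[OF h'] by simp
  qed
  with step.IH show ?case by simp
qed simp


section \<open>The probability that Breaker claims a given set of edges\<close>

text \<open>Estimates the probability that Breaker completes \<open>T\<close> by the time
  \<open>m\<close> edges are free: each of the \<open>f\<close> free edges counts as claimed with
  chance \<open>1 - m / f\<close>, as if independently. For \<open>T\<close> on the board, the value
  \<open>0\<close> means that Maker owns an edge of \<open>T\<close>.\<close>

definition claim_potential :: "nat \<Rightarrow> nat \<Rightarrow> edge set \<Rightarrow> history \<Rightarrow> real" where
  "claim_potential n m T h =
     (if T \<subseteq> set (snd h) \<union> free_edges n h
      then (1 - real m / real (card (free_edges n h))) ^ card (T \<inter> free_edges n h) else 0)"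

text \<open>The left side is the first two terms of the binomial expansion of the right side. The
  induction step drops the term \<open>(j + 1) * a ^ j * c ^ 2\<close>.\<close>

lemma two_terms_le_power:
  fixes a c :: real
  assumes "a \<ge> 0" "c \<ge> 0"
  shows "a ^ j * (a + real (Suc j) * c) \<le> (a + c) ^ Suc j"
proof (induction j)
  case (Suc j)
  have "a ^ Suc j * (a + real (Suc (Suc j)) * c)
      \<le> a ^ j * (a + real (Suc j) * c) * (a + c)"
    using assms by (simp add: algebra_simps)
  also have "\<dots> \<le> (a + c) ^ Suc j * (a + c)"
    using Suc assms by (intro mult_right_mono) auto
  finally show ?case by (simp add: mult.commute)
qed simp

text \<open>A uniformly chosen edge out of \<open>f\<close> hits the \<open>j\<close> relevant ones
  with probability \<open>j / f\<close>; in either case one free edge fewer remains.\<close>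

lemma average_step_le:
  assumes "0 < m" "m < f" "j \<le> f"
  defines "a \<equiv> 1 - real m / real (f - 1)"
  shows "(real j * a ^ (j - 1) + real (f - j) * a ^ j) / real f \<le> (1 - real m / real f) ^ j"
proof (cases j)
  case 0
  then show ?thesis using assms by simp
next
  case (Suc i)
  \<comment> \<open>This is the gain in the base, \<open>a + c = 1 - m / f\<close>, and it brings
    the average into the form \<open>a ^ (j - 1) * (a + j * c)\<close>.\<close>
  define c where "c = (1 - a) / real f"
  have f: "real f > 1" using assms by simp
  have f1: "real (f - 1) = real f - 1" using assms by (simp add: of_nat_diff)
  have a: "a \<ge> 0" "a \<le> 1" using assms f1 by (auto simp: field_simps)
  then have c: "c \<ge> 0" using f by (simp add: c_def)
  have ac: "a + c = 1 - real m / real f"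
    using f by (simp add: c_def a_def f1 divide_simps) (simp add: algebra_simps)
  have "(real j * a ^ (j - 1) + real (f - j) * a ^ j) / real f = a ^ i * (a + real (Suc i) * c)"
    using f assms(3) by (simp add: Suc c_def of_nat_diff field_simps)
  also have "\<dots> \<le> (a + c) ^ Suc i" by (rule two_terms_le_power) fact+
  finally show ?thesis by (simp add: ac Suc)
qed

text \<open>If some edge of \<open>T\<close> is neither Breaker's nor free, the potential is
  \<open>0\<close> before and after. Otherwise, splitting the free edges into those inside and
  outside \<open>T\<close> leads to \<open>average_step_le\<close>.\<close>

lemma claim_potential_breaker_step:
  assumes "0 < m" "m < card (free_edges n h)"
  shows "(\<Sum>e\<in>free_edges n h. claim_potential n m T (fst h, snd h @ [e])) /
      real (card (free_edges n h)) \<le> claim_potential n m T h"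
proof -
  let ?F = "free_edges n h"
  define f where "f = card ?F"
  define j where "j = card (T \<inter> ?F)"
  define a where "a = 1 - real m / real (f - 1)"
  have eq: "set (snd h @ [e]) \<union> (?F - {e}) = set (snd h) \<union> ?F" if "e \<in> ?F" for e
    using that by auto
  show ?thesis
  proof (cases "T \<subseteq> set (snd h) \<union> ?F")
    case False
    then have "claim_potential n m T (fst h, snd h @ [e]) = 0" if "e \<in> ?F" for e
      using eq[OF that] by (simp add: claim_potential_def free_edges_breaker)
    then show ?thesis using False by (simp add: claim_potential_def)
  next
    case True
    have cF: "card (?F - {e}) = f - 1" if "e \<in> ?F" for e using that by (simp add: f_def)
    have in_T: "claim_potential n m T (fst h, snd h @ [e]) = a ^ (j - 1)" if "e \<in> T \<inter> ?F" for e
    proof -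
      have "T \<inter> (?F - {e}) = T \<inter> ?F - {e}" by auto
      moreover have "card (T \<inter> ?F - {e}) = j - 1" using that by (simp add: j_def)
      ultimately show ?thesis using that True eq[of e] cF[of e]
        by (simp add: claim_potential_def free_edges_breaker a_def)
    qed
    have out_T: "claim_potential n m T (fst h, snd h @ [e]) = a ^ j" if "e \<in> ?F - T" for e
    proof -
      have "T \<inter> (?F - {e}) = T \<inter> ?F" using that by auto
      then show ?thesis using that True eq[of e] cF[of e]
        by (simp add: claim_potential_def free_edges_breaker a_def j_def)
    qed
    have "(\<Sum>e\<in>?F. claim_potential n m T (fst h, snd h @ [e]))
        = (\<Sum>e\<in>T \<inter> ?F. claim_potential n m T (fst h, snd h @ [e]))
        + (\<Sum>e\<in>?F - T. claim_potential n m T (fst h, snd h @ [e]))"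
      by (subst sum.union_disjoint[symmetric]) (auto intro!: sum.cong)
    also have "\<dots> = real j * a ^ (j - 1) + real (f - j) * a ^ j"
    proof -
      have "card (?F - T) = f - j"
        unfolding f_def j_def by (metis Int_commute card_Diff_subset_Int finite_Int finite_free_edges)
      then show ?thesis using in_T out_T by (simp add: j_def)
    qed
    finally have sum: "(\<Sum>e\<in>?F. claim_potential n m T (fst h, snd h @ [e]))
      = real j * a ^ (j - 1) + real (f - j) * a ^ j" .
    have "j \<le> f" unfolding j_def f_def by (rule card_mono) auto
    then have "(real j * a ^ (j - 1) + real (f - j) * a ^ j) / real f \<le> (1 - real m / real f) ^ j"
      unfolding a_def using assms by (intro average_step_le) (auto simp: f_def)
    then show ?thesis using True unfolding sum by (simp add: claim_potential_def f_def j_def)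
  qed
qed

lemma claim_potential_nonneg: 
  assumes "m \<le> card (free_edges n h)"
  shows "claim_potential n m T h \<ge> 0"
proof -
  have "real m / real (card (free_edges n h)) \<le> 1" using assms by (intro divide_le_eq_1[THEN iffD2]) linarith
  then show ?thesis by (auto simp: claim_potential_def)
qed

text \<open>The slack \<open>b\<close> keeps more than \<open>m\<close> edges free before each
  single claim, so the estimate for one edge can be iterated and all potentials stay
  nonnegative.\<close>

lemma claim_potential_breaker_turn:
  assumes "0 < m" "m + b \<le> card (free_edges n h)"
  shows "(\<integral>\<^sup>+h'. claim_potential n m T h' \<partial>random_breaker_turn n b h) \<le> claim_potential n m T h"
  using assms(2)
proof (induction b arbitrary: h)
  case 0
  then show ?case by simp
next
  case (Suc b)
  let ?F = "free_edges n h"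
  have ne: "?F \<noteq> {}" using assms(1) Suc.prems by auto
  have card: "card (free_edges n (fst h, snd h @ [e])) = card ?F - 1" if "e \<in> ?F" for e
    using that by (simp add: free_edges_breaker)
  have "(\<integral>\<^sup>+h'. claim_potential n m T h' \<partial>random_breaker_turn n (Suc b) h)
      = (\<Sum>e\<in>?F. \<integral>\<^sup>+h'. claim_potential n m T h'
            \<partial>random_breaker_turn n b (fst h, snd h @ [e])) / ennreal (real (card ?F))"
    using ne by (simp add: nn_integral_bind_pmf nn_integral_pmf_of_set ennreal_of_nat_eq_real_of_nat)
  also have "\<dots> \<le> (\<Sum>e\<in>?F. ennreal (claim_potential n m T (fst h, snd h @ [e])))
      / ennreal (real (card ?F))"
    using Suc.prems by (intro divide_right_mono_ennreal sum_mono Suc.IH) (auto simp: card)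
  also have "(\<Sum>e\<in>?F. ennreal (claim_potential n m T (fst h, snd h @ [e])))
      = ennreal (\<Sum>e\<in>?F. claim_potential n m T (fst h, snd h @ [e]))"
    using Suc.prems by (intro sum_ennreal claim_potential_nonneg) (auto simp: card)
  also have "\<dots> / ennreal (real (card ?F))
      = ennreal ((\<Sum>e\<in>?F. claim_potential n m T (fst h, snd h @ [e])) / real (card ?F))"
    using Suc.prems assms(1)
    by (intro divide_ennreal sum_nonneg claim_potential_nonneg) (auto simp: card)
  also have "\<dots> \<le> ennreal (claim_potential n m T h)"
    using assms(1) Suc.prems by (intro ennreal_leI claim_potential_breaker_step) auto
  finally show ?case .
qed

text \<open>If Maker takes an edge of \<open>T\<close>, the potential drops to \<open>0\<close>; if
  he takes another edge, fewer edges are free and the base of the power shrinks.\<close>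

lemma claim_potential_maker_turn:
  assumes "0 < m" "m < card (free_edges n h)" "legal_strategy n S"
  shows "claim_potential n m T (maker_turn n S h) \<le> claim_potential n m T h"
proof -
  let ?F = "free_edges n h"
  have ne: "?F \<noteq> {}" using assms by auto
  note S = maker_turn_legal[OF assms(3) ne]
  have nonneg: "claim_potential n m T h \<ge> 0" using assms by (intro claim_potential_nonneg) auto
  show ?thesis
  proof (cases "T \<subseteq> set (snd h) \<union> (?F - {S h})")
    case False
    then show ?thesis using nonneg S by (simp add: claim_potential_def free_edges_maker)
  next
    case True
    moreover have "S h \<notin> set (snd h)" using S(1) by (auto simp: free_edges_def)
    ultimately have T: "T \<inter> (?F - {S h}) = T \<inter> ?F" "T \<subseteq> set (snd h) \<union> ?F" by auto
    have "real m / real (card ?F) \<le> real m / real (card ?F - 1)"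
      using assms by (intro divide_left_mono) auto
    moreover have "real m / real (card ?F - 1) \<le> 1" using assms by simp
    ultimately have "(1 - real m / real (card ?F - 1)) ^ card (T \<inter> ?F)
        \<le> (1 - real m / real (card ?F)) ^ card (T \<inter> ?F)"
      by (intro power_mono) auto
    then show ?thesis using True T S by (simp add: claim_potential_def free_edges_maker)
  qed
qed

text \<open>The potential is a supermartingale starting at the right-hand side, and it equals
  \<open>1\<close> once Breaker owns \<open>T\<close>, because then no edge of \<open>T\<close> is
  free.\<close>

lemma prob_breaker_claims:
  assumes "legal_strategy n S" "0 < m" "m + t * (b + 1) \<le> card (board n)" "T \<subseteq> board n"
  shows "measure_pmf.prob (half_random_play n b S t) {h. T \<subseteq> set (snd h)}
     \<le> (1 - real m / real (card (board n))) ^ card T"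
proof -
  let ?c = "(1 - real m / real (card (board n))) ^ card T"
  have main: "(\<integral>\<^sup>+h. claim_potential n m T h \<partial>half_random_play n b S t) \<le> ennreal ?c"
    using assms(3)
  proof (induction t)
    case 0
    have "T \<inter> board n = T" using assms(4) by auto
    then show ?case using assms(4) by (simp add: claim_potential_def free_edges_def)
  next
    case (Suc t)
    have "(\<integral>\<^sup>+h. claim_potential n m T h \<partial>half_random_play n b S (Suc t))
        = (\<integral>\<^sup>+h. (\<integral>\<^sup>+h'. claim_potential n m T h'
            \<partial>random_breaker_turn n b (maker_turn n S h)) \<partial>half_random_play n b S t)"
      by (simp add: nn_integral_bind_pmf)
    also have "\<dots> \<le> (\<integral>\<^sup>+h. claim_potential n m T h \<partial>half_random_play n b S t)"
    proof (rule nn_integral_mono_AE, unfold AE_measure_pmf_iff, intro ballI)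
      fix h assume h: "h \<in> set_pmf (half_random_play n b S t)"
      have f: "m + (b + 1) \<le> card (free_edges n h)"
        using card_free_play[OF assms(1) h] Suc.prems by simp
      have "(\<integral>\<^sup>+h'. claim_potential n m T h' \<partial>random_breaker_turn n b (maker_turn n S h))
          \<le> claim_potential n m T (maker_turn n S h)"
        using f assms(2) by (intro claim_potential_breaker_turn)
          (auto simp: card_free_maker_turn[OF assms(1)])
      also have "\<dots> \<le> claim_potential n m T h"
        using f assms by (intro ennreal_leI claim_potential_maker_turn) auto
      finally show "(\<integral>\<^sup>+h'. claim_potential n m T h' \<partial>random_breaker_turn n b (maker_turn n S h))
          \<le> claim_potential n m T h" .
    qed
    also have "\<dots> \<le> ennreal ?c" using Suc by simp
    finally show ?case .
  qed
  have "emeasure (half_random_play n b S t) {h. T \<subseteq> set (snd h)}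
      = (\<integral>\<^sup>+h. indicator {h. T \<subseteq> set (snd h)} h \<partial>half_random_play n b S t)" by simp
  also have "\<dots> \<le> (\<integral>\<^sup>+h. claim_potential n m T h \<partial>half_random_play n b S t)"
  proof (rule nn_integral_mono)
    fix h :: history
    show "indicator {h. T \<subseteq> set (snd h)} h \<le> ennreal (claim_potential n m T h)"
    proof (cases "T \<subseteq> set (snd h)")
      case True
      then have "T \<inter> free_edges n h = {}" by (auto simp: free_edges_def)
      moreover have "T \<subseteq> set (snd h) \<union> free_edges n h" using True by auto
      ultimately have "claim_potential n m T h = 1" by (simp add: claim_potential_def)
      then show ?thesis by (simp add: indicator_def)
    qed simp
  qed
  also note main
  finally have "ennreal (measure_pmf.prob (half_random_play n b S t) {h. T \<subseteq> set (snd h)}) \<le> ennreal ?c"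
    by (simp add: measure_pmf.emeasure_eq_measure)
  moreover have "?c \<ge> 0" using assms(3) by (auto intro!: zero_le_power simp: divide_le_eq_1)
  ultimately show ?thesis by simp
qed

text \<open>The potential of \<open>{e}\<close> over a single turn. With \<open>m'\<close> the exact
  number of edges left free after the turn, its initial value is \<open>b / f\<close>, where
  \<open>f \<ge> m\<close> edges are free before.\<close>

lemma prob_breaker_turn_claims:
  assumes "0 < m" "m + b \<le> card (free_edges n h)" "e \<in> free_edges n h"
  shows "measure_pmf.prob (random_breaker_turn n b h) {h'. e \<in> set (snd h')} \<le> real b / real m"
proof -
  define m' where "m' = card (free_edges n h) - b"
  have m': "m \<le> m'" "m' + b = card (free_edges n h)" using assms by (auto simp: m'_def)
  have "emeasure (random_breaker_turn n b h) {h'. e \<in> set (snd h')}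
      = (\<integral>\<^sup>+h'. indicator {h'. e \<in> set (snd h')} h' \<partial>random_breaker_turn n b h)" by simp
  also have "\<dots> \<le> (\<integral>\<^sup>+h'. claim_potential n m' {e} h' \<partial>random_breaker_turn n b h)"
  proof (rule nn_integral_mono)
    fix h' :: history
    show "indicator {h'. e \<in> set (snd h')} h' \<le> ennreal (claim_potential n m' {e} h')"
    proof (cases "e \<in> set (snd h')")
      case True
      then have "{e} \<inter> free_edges n h' = {}" by (auto simp: free_edges_def)
      then have "claim_potential n m' {e} h' = 1" using True by (simp add: claim_potential_def)
      then show ?thesis by (simp add: indicator_def)
    qed simp
  qed
  also have "\<dots> \<le> claim_potential n m' {e} h"
    using assms m' by (intro claim_potential_breaker_turn) auto
  also have "claim_potential n m' {e} h = real b / real (card (free_edges n h))"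
    using assms(1,3) m' by (simp add: claim_potential_def flip: m'(2)) (simp add: field_simps)
  finally have "measure_pmf.prob (random_breaker_turn n b h) {h'. e \<in> set (snd h')}
      \<le> real b / real (card (free_edges n h))"
    by (simp add: measure_pmf.emeasure_eq_measure)
  also have "\<dots> \<le> real b / real m"
    using assms by (intro divide_left_mono) auto
  finally show ?thesis .
qed

section \<open>Strategies from invariants\<close>

text \<open>A strategy sees only the history, so an invariant depending on the round requires that
  the round can be read off Maker's list.\<close>

lemma length_maker_play:
  assumes "legal_strategy n S" "h \<in> set_pmf (half_random_play n b S t)"
    "t * (b + 1) \<le> card (board n)"
  shows "length (fst h) = t"
  using assms(2,3)
proof (induction t arbitrary: h)
  case (Suc t)
  then obtain h0 where h0: "h0 \<in> set_pmf (half_random_play n b S t)"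
    "h \<in> set_pmf (random_breaker_turn n b (maker_turn n S h0))" by auto
  have "card (free_edges n h0) > 0"
    using card_free_play[OF assms(1) h0(1)] Suc.prems(2) by simp
  then have "free_edges n h0 \<noteq> {}" by auto
  then show ?case
    using Suc.IH[OF h0(1)] Suc.prems(2) random_breaker_turn_support(1)[OF h0(2)]
      maker_turn_legal(2)[OF assms(1)] by simp
qed simp

text \<open>The good event \<open>G\<close> is about Breaker's final graph, yet Maker may rely on it in every round,
  because it is inherited by the past.\<close>
lemma strategy_from_invariant:
  fixes P :: "nat \<Rightarrow> history \<Rightarrow> bool" and \<beta> :: "nat \<Rightarrow> real"
  assumes start: "P 0 ([], [])"
    and maker: "\<And>t h. t < T \<Longrightarrow> P t h \<Longrightarrow> G (set (snd h)) \<Longrightarrow> free_edges n h \<noteq> {} \<Longrightarrow>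
      \<exists>e\<in>free_edges n h. P (Suc t) (fst h @ [e], snd h)"
    and breaker: "\<And>t h. t < T \<Longrightarrow> P (Suc t) h \<Longrightarrow> m + b \<le> card (free_edges n h) \<Longrightarrow>
      measure_pmf.prob (random_breaker_turn n b h) {h'. \<not> P (Suc t) h'} \<le> \<beta> t"
    and nonneg: "\<And>t. \<beta> t \<ge> 0"
    and antimono: "\<And>B B'. G B' \<Longrightarrow> B \<subseteq> B' \<Longrightarrow> G B"
    and m: "m + T * (b + 1) \<le> card (board n)"
  obtains S where "legal_strategy n S"
    "measure_pmf.prob (half_random_play n b S T) {h. \<not> P T h}
      \<le> measure_pmf.prob (half_random_play n b S T) {h. \<not> G (set (snd h))} + (\<Sum>t<T. \<beta> t)"
proof -
  \<comment> \<open>A free edge that carries the invariant over to the next round. \<open>S\<close>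
    chooses one if possible; its second branch only keeps it legal on all other histories.\<close>
  define Q where "Q h e \<longleftrightarrow>
    e \<in> free_edges n h \<and> P (Suc (length (fst h))) (fst h @ [e], snd h)" for h e
  define S where "S h = (if \<exists>e. Q h e then SOME e. Q h e else SOME e. e \<in> free_edges n h)" for h
  have S_Q: "Q h (S h)" if "\<exists>e. Q h e" for h
    using someI_ex[OF that] that by (simp add: S_def)
  have legal: "legal_strategy n S"
    unfolding legal_strategy_def
  proof (intro allI impI)
    fix h assume "free_edges n h \<noteq> {}"
    then have "(SOME e. e \<in> free_edges n h) \<in> free_edges n h" by (simp add: some_in_eq)
    then show "S h \<in> free_edges n h" using S_Q[of h] by (cases "\<exists>e. Q h e") (auto simp: Q_def S_def)
  qed
  \<comment> \<open>Intersecting the failure event with \<open>G\<close> makes it additive: round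
    \<open>t\<close> contributes at most \<open>\<beta> t\<close>, and the failure of
    \<open>G\<close> is paid for once, at the end.\<close>
  have main: "measure_pmf.prob (half_random_play n b S t) {h. G (set (snd h)) \<and> \<not> P t h}
      \<le> (\<Sum>i<t. \<beta> i)" if "t \<le> T" for t
    using that
  proof (induction t)
    case 0
    then show ?case using start by (simp add: indicator_def)
  next
    case (Suc t)
    have "measure_pmf.prob (half_random_play n b S (Suc t)) {h. G (set (snd h)) \<and> \<not> P (Suc t) h}
      \<le> measure_pmf.prob (half_random_play n b S t) {h. G (set (snd h)) \<and> \<not> P t h} + \<beta> t"
      unfolding half_random_play.simps
    proof (rule prob_bind_le)
      fix h assume h: "h \<in> set_pmf (half_random_play n b S t)"
        and nbad: "h \<notin> {h. G (set (snd h)) \<and> \<not> P t h}"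
      let ?turn = "random_breaker_turn n b (maker_turn n S h)"
      have "m + Suc t * (b + 1) \<le> m + T * (b + 1)" using Suc.prems by (intro add_left_mono mult_right_mono) auto
      then have mt: "m + (b + 1) + t * (b + 1) \<le> card (board n)" using m by simp
      have len: "length (fst h) = t" using length_maker_play[OF legal h] mt by simp
      have free: "m + (b + 1) \<le> card (free_edges n h)"
        using card_free_play[OF legal h] mt by simp
      then have ne: "free_edges n h \<noteq> {}" by auto
      show "measure_pmf.prob ?turn {h. G (set (snd h)) \<and> \<not> P (Suc t) h} \<le> \<beta> t"
      proof (cases "G (set (snd h))")
        \<comment> \<open>A violated \<open>G\<close> stays violated as Breaker's set grows, so such
          a history contributes nothing.\<close>
        case False
        have "\<not> G (set (snd h'))" if "h' \<in> set_pmf ?turn" for h'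
          using random_breaker_turn_support(2)[OF that] False antimono by auto
        then have "measure_pmf.prob ?turn {h. G (set (snd h)) \<and> \<not> P (Suc t) h} = 0"
          by (auto simp: measure_pmf_zero_iff disjoint_iff)
        then show ?thesis using nonneg by simp
      next
        case True
        with nbad have "P t h" by simp
        with maker[of t h] True Suc.prems len ne have "\<exists>e. Q h e" by (auto simp: Q_def)
        from S_Q[OF this] have "P (Suc t) (maker_turn n S h)"
          using len maker_turn_legal(2)[OF legal ne] by (simp add: Q_def)
        moreover have "m + b \<le> card (free_edges n (maker_turn n S h))"
          using free card_free_maker_turn[OF legal] by simp
        ultimately have "measure_pmf.prob ?turn {h. \<not> P (Suc t) h} \<le> \<beta> t"
          using breaker Suc.prems by auto
        moreover have "measure_pmf.prob ?turn {h. G (set (snd h)) \<and> \<not> P (Suc t) h}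
            \<le> measure_pmf.prob ?turn {h. \<not> P (Suc t) h}"
          by (intro measure_pmf.finite_measure_mono) auto
        ultimately show ?thesis by simp
      qed
    qed (rule nonneg)
    then show ?case using Suc by simp
  qed
  have "measure_pmf.prob (half_random_play n b S T) {h. \<not> P T h}
      \<le> measure_pmf.prob (half_random_play n b S T)
          ({h. \<not> G (set (snd h))} \<union> {h. G (set (snd h)) \<and> \<not> P T h})"
    by (intro measure_pmf.finite_measure_mono) auto
  also have "\<dots> \<le> measure_pmf.prob (half_random_play n b S T) {h. \<not> G (set (snd h))}
      + measure_pmf.prob (half_random_play n b S T) {h. G (set (snd h)) \<and> \<not> P T h}"
    by (rule measure_Un_le) auto
  finally show ?thesis using that[OF legal] main[of T] by simp
qed


section \<open>Breaker's graph is not too dense\<close>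

text \<open>Only Breaker's edges enter, so the condition is antimonotone and can be bounded for
  every strategy of Maker. That the edges found are not Maker's is argued where they are
  used.\<close>

definition sparse_breaker :: "nat \<Rightarrow> nat \<Rightarrow> nat \<Rightarrow> edge set \<Rightarrow> bool" where
  "sparse_breaker n k d B \<longleftrightarrow>
     (\<forall>X Y. X \<subseteq> {..<n} \<longrightarrow> Y \<subseteq> {..<n} \<longrightarrow> X \<inter> Y = {} \<longrightarrow> card X = k \<longrightarrow> card Y = k \<longrightarrow>
        (\<exists>x\<in>X. \<exists>y\<in>Y. {x, y} \<notin> B)) \<and>
     (\<forall>v<n. d \<le> card {w. w < n \<and> w \<noteq> v \<and> {v, w} \<notin> B})"

lemma sparse_breaker_antimono:
  assumes "sparse_breaker n k d B'" "B \<subseteq> B'"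
  shows "sparse_breaker n k d B"
proof -
  have "d \<le> card {w. w < n \<and> w \<noteq> v \<and> {v, w} \<notin> B}" if "v < n" for v
  proof -
    have "d \<le> card {w. w < n \<and> w \<noteq> v \<and> {v, w} \<notin> B'}"
      using assms(1) that by (simp add: sparse_breaker_def)
    also have "\<dots> \<le> card {w. w < n \<and> w \<noteq> v \<and> {v, w} \<notin> B}"
      using assms(2) by (intro card_mono) auto
    finally show ?thesis .
  qed
  moreover have "\<exists>x\<in>X. \<exists>y\<in>Y. {x, y} \<notin> B"
    if "X \<subseteq> {..<n}" "Y \<subseteq> {..<n}" "X \<inter> Y = {}" "card X = k" "card Y = k" for X Y
  proof -
    have "\<exists>x\<in>X. \<exists>y\<in>Y. {x, y} \<notin> B'"
      using assms(1) that unfolding sparse_breaker_def by blast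
    then show ?thesis using assms(2) by blast
  qed
  ultimately show ?thesis unfolding sparse_breaker_def by blast
qed

lemma card_subsets_le_power: "card {X. X \<subseteq> {..<n} \<and> card X = k} \<le> n ^ k"
proof (cases "k \<le> n")
  case True
  then show ?thesis using binomial_le_pow[OF True] by (simp add: n_subsets)
qed (simp add: n_subsets binomial_eq_0)

lemma card_pairs_disjoint:
  assumes "finite X" "finite Y" "X \<inter> Y = {}"
  shows "card ((\<lambda>(x, y). {x, y}) ` (X \<times> Y)) = card X * card Y"
proof -
  have "inj_on (\<lambda>(x, y). {x, y}) (X \<times> Y)"
    using assms(3) by (auto simp: inj_on_def doubleton_eq_iff)
  then show ?thesis by (simp add: card_image card_cartesian_product)
qed

text \<open>Union bound. There are at most \<open>n ^ (2 * k)\<close> pairs \<open>X\<close>,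
  \<open>Y\<close>, each with \<open>k * k\<close> edges in between. A vertex violating the degree
  condition has \<open>n - d\<close> Breaker neighbours, which leaves at most
  \<open>n * n ^ d\<close> choices of the vertex and this set.\<close>

lemma prob_not_sparse_breaker:
  assumes legal: "legal_strategy n S" and m: "0 < m" "m + t * (b + 1) \<le> card (board n)"
    and d: "d \<le> n"
  defines "x \<equiv> 1 - real m / real (card (board n))"
  shows "measure_pmf.prob (half_random_play n b S t) {h. \<not> sparse_breaker n k d (set (snd h))}
    \<le> real n ^ (2 * k) * x ^ (k * k) + real n ^ (d + 1) * x ^ (n - d)"
proof -
  let ?pr = "measure_pmf.prob (half_random_play n b S t)"
  define J where "J X Y = (\<lambda>(x, y). {x, y}) ` (X \<times> Y)" for X Y :: "nat set"
  define I where "I = {X. X \<subseteq> {..<n} \<and> card X = k}"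
  define A1 where "A1 = {(X, Y) \<in> I \<times> I. X \<inter> Y = {}}"
  define A2 where "A2 = (SIGMA v:{..<n}. {W. W \<subseteq> {..<n} - {v} \<and> card W = n - d})"
  define C where "C E = {h :: history. E \<subseteq> set (snd h)}" for E
  have x: "0 \<le> x" using m by (auto simp: x_def divide_le_eq_1)
  have fin: "finite I" "finite A1" "finite A2"
  proof -
    show "finite I" by (simp add: I_def)
    then have "finite (I \<times> I)" by simp
    then show "finite A1" by (rule finite_subset[rotated]) (auto simp: A1_def)
    show "finite A2" unfolding A2_def by (intro finite_SigmaI) auto
  qed
  have bound: "?pr (C (J X Y)) \<le> x ^ (card X * card Y)"
    if "X \<subseteq> {..<n}" "Y \<subseteq> {..<n}" "X \<inter> Y = {}" for X Y
  proof -
    have "finite X" "finite Y" using that(1,2) finite_subset by blast+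
    then have "card (J X Y) = card X * card Y" using card_pairs_disjoint that(3) by (simp add: J_def)
    moreover have "J X Y \<subseteq> board n"
      using that by (force simp: J_def intro!: doubleton_in_board)
    ultimately show ?thesis
      using prob_breaker_claims[OF legal m, of "J X Y"] by (simp add: C_def x_def)
  qed
  have sub: "{h. \<not> sparse_breaker n k d (set (snd h))}
      \<subseteq> (\<Union>(X, Y)\<in>A1. C (J X Y)) \<union> (\<Union>(v, W)\<in>A2. C (J {v} W))"
  proof
    fix h :: history assume "h \<in> {h. \<not> sparse_breaker n k d (set (snd h))}"
    then consider (1) X Y where "X \<subseteq> {..<n}" "Y \<subseteq> {..<n}" "X \<inter> Y = {}" "card X = k" "card Y = k"
        "\<forall>x\<in>X. \<forall>y\<in>Y. {x, y} \<in> set (snd h)"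
      | (2) v where "v < n" "card {w. w < n \<and> w \<noteq> v \<and> {v, w} \<notin> set (snd h)} < d"
      unfolding sparse_breaker_def by (auto simp: not_le)
    then show "h \<in> (\<Union>(X, Y)\<in>A1. C (J X Y)) \<union> (\<Union>(v, W)\<in>A2. C (J {v} W))"
    proof cases
      case 1
      then have "(X, Y) \<in> A1" "h \<in> C (J X Y)" by (auto simp: A1_def I_def C_def J_def)
      then show ?thesis by blast
    next
      case 2
      let ?N = "{w. w < n \<and> w \<noteq> v \<and> {v, w} \<notin> set (snd h)}"
      \<comment> \<open>At most \<open>d - 1\<close> vertices lie in \<open>?N\<close>, which makes
        up for the vertex \<open>v\<close> itself: \<open>n - d\<close> Breaker neighbours
        remain.\<close>
      have "card ({..<n} - {v} - ?N) = n - 1 - card ?N"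
        using 2(1) by (subst card_Diff_subset) auto
      then have "n - d \<le> card ({..<n} - {v} - ?N)" using 2(2) by simp
      then obtain W where W: "W \<subseteq> {..<n} - {v} - ?N" "card W = n - d"
        by (rule obtain_subset_with_card_n)
      then have "(v, W) \<in> A2" "h \<in> C (J {v} W)" using 2(1) by (auto simp: A2_def C_def J_def)
      then show ?thesis by blast
    qed
  qed
  have "?pr {h. \<not> sparse_breaker n k d (set (snd h))}
      \<le> ?pr ((\<Union>(X, Y)\<in>A1. C (J X Y)) \<union> (\<Union>(v, W)\<in>A2. C (J {v} W)))"
    by (intro measure_pmf.finite_measure_mono sub) auto
  also have "\<dots> \<le> ?pr (\<Union>(X, Y)\<in>A1. C (J X Y)) + ?pr (\<Union>(v, W)\<in>A2. C (J {v} W))"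
    by (rule measure_Un_le) auto
  also have "?pr (\<Union>(X, Y)\<in>A1. C (J X Y)) \<le> (\<Sum>(X, Y)\<in>A1. ?pr (C (J X Y)))"
    using measure_pmf.finite_measure_subadditive_finite[OF fin(2), of "\<lambda>(X, Y). C (J X Y)"]
    by (simp add: case_prod_unfold)
  also have "\<dots> \<le> (\<Sum>_\<in>A1. x ^ (k * k))"
  proof (intro sum_mono, clarify)
    fix X Y assume "(X, Y) \<in> A1"
    then have "X \<subseteq> {..<n}" "Y \<subseteq> {..<n}" "X \<inter> Y = {}" "card X = k" "card Y = k"
      by (simp_all add: A1_def I_def)
    then show "?pr (C (J X Y)) \<le> x ^ (k * k)" using bound[of X Y] by simp
  qed
  also have "\<dots> \<le> real n ^ (2 * k) * x ^ (k * k)"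
  proof -
    have "card A1 \<le> card (I \<times> I)" by (intro card_mono) (auto simp: A1_def fin)
    also have "\<dots> \<le> n ^ k * n ^ k"
      unfolding card_cartesian_product using card_subsets_le_power[of n k]
      by (intro mult_mono) (auto simp: I_def)
    finally have "real (card A1) \<le> real (n ^ k * n ^ k)" by (rule of_nat_mono)
    also have "\<dots> = real n ^ (2 * k)" by (simp add: mult_2 power_add)
    finally show ?thesis using x by (simp add: mult_right_mono)
  qed
  also have "?pr (\<Union>(v, W)\<in>A2. C (J {v} W)) \<le> (\<Sum>(v, W)\<in>A2. ?pr (C (J {v} W)))"
    using measure_pmf.finite_measure_subadditive_finite[OF fin(3), of "\<lambda>(v, W). C (J {v} W)"]
    by (simp add: case_prod_unfold)
  also have "\<dots> \<le> (\<Sum>_\<in>A2. x ^ (n - d))"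
  proof (intro sum_mono, clarify)
    fix v W assume "(v, W) \<in> A2"
    then show "?pr (C (J {v} W)) \<le> x ^ (n - d)"
      using bound[of "{v}" W] by (auto simp: A2_def)
  qed
  also have "\<dots> \<le> real n ^ (d + 1) * x ^ (n - d)"
  proof -
    have "card A2 = (\<Sum>v<n. card {W. W \<subseteq> {..<n} - {v} \<and> card W = n - d})"
      unfolding A2_def by (subst card_SigmaI) auto
    also have "\<dots> \<le> (\<Sum>v<n. n ^ d)"
    proof (intro sum_mono)
      fix v
      have "card {W. W \<subseteq> {..<n} - {v} \<and> card W = n - d}
          \<le> card {W. W \<subseteq> {..<n} \<and> card W = n - d}"
        by (intro card_mono) auto
      also have "\<dots> = n choose d" using d by (simp add: n_subsets binomial_symmetric[OF d])
      also have "\<dots> \<le> n ^ d" using d by (rule binomial_le_pow)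
      finally show "card {W. W \<subseteq> {..<n} - {v} \<and> card W = n - d} \<le> n ^ d" .
    qed
    finally have "real (card A2) \<le> real (n ^ (d + 1))" by (intro of_nat_mono) simp
    also have "\<dots> = real n ^ (d + 1)" by simp
    finally show ?thesis using x by (simp only: sum_constant) (intro mult_right_mono, auto)
  qed
  finally show ?thesis by simp
qed

lemma sparse_breaker_pair:
  assumes "sparse_breaker n k d B" "X \<subseteq> {..<n}" "Y \<subseteq> {..<n}" "X \<inter> Y = {}" "card X = k" "card Y = k"
  shows "\<exists>x\<in>X. \<exists>y\<in>Y. {x, y} \<notin> B"
  using assms unfolding sparse_breaker_def by blast


section \<open>The perfect matching game\<close>

definition fixed_points :: "nat \<Rightarrow> (nat \<Rightarrow> nat) \<Rightarrow> nat set" where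
  "fixed_points n p = {x. x < n \<and> p x = x}"

text \<open>A matching inside Maker's graph is encoded as an involution \<open>p\<close> whose fixed points are the
  unmatched vertices; the remaining edges of Maker live on the set \<open>W\<close>.\<close>
definition matching_state :: "nat \<Rightarrow> (nat \<Rightarrow> nat) \<Rightarrow> nat set \<Rightarrow> edge set \<Rightarrow> bool" where
  "matching_state n p W E \<longleftrightarrow> finite W \<and> (\<forall>x<n. p x < n \<and> p (p x) = x) \<and>
     (\<forall>x<n. p x \<noteq> x \<longrightarrow> {x, p x} \<in> E) \<and>
     (\<forall>e\<in>E. e \<subseteq> W \<or> (\<exists>x<n. p x \<noteq> x \<and> e = {x, p x}))"

lemma finite_fixed_points [simp]: "finite (fixed_points n p)"
  by (simp add: fixed_points_def)

section \<open>Updating the matching\<close>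

lemma matching_state_join:
  assumes "matching_state n p W E" "u \<in> fixed_points n p" "v \<in> fixed_points n p" "u \<noteq> v"
  shows "matching_state n (p(u := v, v := u)) W (insert {u, v} E)"
    and "fixed_points n (p(u := v, v := u)) = fixed_points n p - {u, v}"
proof -
  note st = assms(1)[unfolded matching_state_def]
  have uv: "u < n" "v < n" "p u = u" "p v = v" using assms by (auto simp: fixed_points_def)
  \<comment> \<open>An involution is injective, so no other vertex points to \<open>u\<close> or
    \<open>v\<close> and the remaining pairs are undisturbed.\<close>
  have inv: "p z = u \<longleftrightarrow> z = u" "p z = v \<longleftrightarrow> z = v" if "z < n" for z
    using st uv that by metis+
  let ?p = "p(u := v, v := u)"
  have old: "?p z = p z \<and> z \<noteq> u \<and> z \<noteq> v" if "z < n" "p z \<noteq> z" for z using uv that by auto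
  have "\<exists>x<n. ?p x \<noteq> x \<and> e = {x, ?p x}" if "e \<in> insert {u, v} E" "\<not> e \<subseteq> W" for e
  proof (cases "e = {u, v}")
    case True
    then show ?thesis using uv assms(4) by (intro exI[of _ u]) auto
  next
    case False
    with that st obtain x where x: "x < n" "p x \<noteq> x" "e = {x, p x}" by blast
    then show ?thesis using old[of x] by (intro exI[of _ x]) simp
  qed
  moreover have "?p x < n \<and> ?p (?p x) = x" "?p x \<noteq> x \<longrightarrow> {x, ?p x} \<in> insert {u, v} E" if "x < n" for x
    using st uv inv[OF that] assms(4) that by (auto simp: insert_commute)
  moreover have "finite W" using st by blast
  ultimately show "matching_state n ?p W (insert {u, v} E)"
    unfolding matching_state_def by blast
  show "fixed_points n ?p = fixed_points n p - {u, v}"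
    using uv assms(4) by (auto simp: fixed_points_def)
qed

text \<open>Along the path \<open>u, x, p x, p y, y\<close> the edges \<open>{u, x}\<close> and
  \<open>{p x, p y}\<close> replace \<open>{x, p x}\<close> and \<open>{y, p y}\<close>. The gap
  moves from \<open>u\<close> to \<open>y\<close>, and the discarded edges are accounted for by
  \<open>W\<close>.\<close>

lemma matching_state_rotate:
  assumes st: "matching_state n p W E"
    and u: "u \<in> fixed_points n p" and xy: "x < n" "y < n" "p x \<noteq> x" "p y \<noteq> y" "x \<noteq> y" "x \<noteq> p y"
    and W: "{x, p x, y, p y} \<subseteq> W" and e: "{p x, p y} \<in> E"
  defines "p' \<equiv> p(u := x, x := u, p x := p y, p y := p x, y := y)"
  shows "matching_state n p' W (insert {u, x} E)"
    and "fixed_points n p' = insert y (fixed_points n p - {u})"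
proof -
  note st' = st[unfolded matching_state_def]
  have uu: "u < n" "p u = u" using u by (auto simp: fixed_points_def)
  have lt: "p x < n" "p y < n" "p (p x) = x" "p (p y) = y" using st' xy by auto
  have dist: "p x \<noteq> p y" "p x \<noteq> y" "u \<noteq> x" "u \<noteq> y" "u \<noteq> p x" "u \<noteq> p y"
    using lt xy uu by metis+
  have p': "p' u = x" "p' x = u" "p' (p x) = p y" "p' (p y) = p x" "p' y = y"
    using dist xy by (auto simp: p'_def)
  have old: "p' z = p z" if "z \<notin> {u, x, p x, p y, y}" for z using that by (simp add: p'_def)
  have old': "p z \<notin> {u, x, p x, p y, y}" if "z < n" "z \<notin> {u, x, p x, p y, y}" for z
    using that st' lt uu by (metis insert_iff empty_iff)
  have inv: "p' z < n \<and> p' (p' z) = z" if "z < n" for z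
  proof (cases "z \<in> {u, x, p x, p y, y}")
    case True
    then show ?thesis using p' uu lt xy by auto
  next
    case False
    then show ?thesis using old[OF False] old[OF old'[OF that False]] st' that by simp
  qed
  have edge: "{z, p' z} \<in> insert {u, x} E" if "z < n" "p' z \<noteq> z" for z
  proof (cases "z \<in> {u, x, p x, p y, y}")
    case True
    then show ?thesis using p' e that by (auto simp: insert_commute)
  next
    case False
    then show ?thesis using old[OF False] st' that by simp
  qed
  have garb: "e \<subseteq> W \<or> (\<exists>z<n. p' z \<noteq> z \<and> e = {z, p' z})" if "e \<in> insert {u, x} E" for e
  proof (cases "e = {u, x} \<or> e \<subseteq> W")
    case True
    then show ?thesis using p'(1) uu dist by auto
  next
    case False
    with that st' obtain z where z: "z < n" "p z \<noteq> z" "e = {z, p z}" by blast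
    have "z \<notin> {u, x, p x, p y, y}"
    proof
      assume "z \<in> {u, x, p x, p y, y}"
      then have "e \<subseteq> W" using z uu lt W by auto
      then show False using False by simp
    qed
    then show ?thesis using old z by auto
  qed
  show "matching_state n p' W (insert {u, x} E)"
    unfolding matching_state_def
  proof (intro conjI allI impI ballI)
    show "finite W" using st' by simp
  qed (use inv edge garb in simp_all)
  show "fixed_points n p' = insert y (fixed_points n p - {u})"
  proof (intro set_eqI)
    fix z
    show "z \<in> fixed_points n p' \<longleftrightarrow> z \<in> insert y (fixed_points n p - {u})"
    proof (cases "z \<in> {u, x, p x, p y, y}")
      case True
      then have "z \<in> fixed_points n p' \<longleftrightarrow> z = y" "z \<notin> fixed_points n p - {u}"
        by (elim insertE emptyE;
            simp add: fixed_points_def p' uu lt xy dist dist[symmetric] xy(5)[symmetric] xy(3,4)[symmetric])+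
      then show ?thesis by blast
    next
      case False
      then show ?thesis using old[OF False] by (auto simp: fixed_points_def)
    qed
  qed
qed

text \<open>To match two unmatched vertices \<open>u, v\<close>, Maker picks matching edges \<open>{x, p x}\<close> and
  \<open>{y, p y}\<close> such that the edges of the augmenting path \<open>u, x, p x, p y, y, v\<close> outside the
  matching are free, and claims them in three consecutive moves, starting with the middle one.
  The three predicates describe the position before each of these moves, with \<open>2 r\<close> vertices
  unmatched. For \<open>r \<ge> k\<close> truncated subtraction forces \<open>W = {}\<close> in the first one.\<close>
definition idle_state :: "nat \<Rightarrow> nat \<Rightarrow> nat \<Rightarrow> history \<Rightarrow> bool" where
  "idle_state n k r h \<longleftrightarrow> (\<exists>p W. matching_state n p W (set (fst h)) \<and>
     card (fixed_points n p) = 2 * r \<and> card W \<le> 4 * (k - r))"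

definition linked_state :: "nat \<Rightarrow> nat \<Rightarrow> nat \<Rightarrow> history \<Rightarrow> bool" where
  "linked_state n k r h \<longleftrightarrow> (\<exists>p W u v x y. matching_state n p W (set (fst h)) \<and>
     card (fixed_points n p) = 2 * r \<and> card W \<le> 4 * (k - r) + 4 \<and>
     u \<in> fixed_points n p \<and> v \<in> fixed_points n p \<and> u \<noteq> v \<and>
     x < n \<and> y < n \<and> p x \<noteq> x \<and> p y \<noteq> y \<and> x \<noteq> y \<and> x \<noteq> p y \<and> {x, p x, y, p y} \<subseteq> W \<and>
     {p x, p y} \<in> set (fst h) \<and> {u, x} \<in> free_edges n h \<and> {v, y} \<in> free_edges n h)"

definition closing_state :: "nat \<Rightarrow> nat \<Rightarrow> nat \<Rightarrow> history \<Rightarrow> bool" where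
  "closing_state n k r h \<longleftrightarrow> (\<exists>p W u v. matching_state n p W (set (fst h)) \<and>
     card (fixed_points n p) = 2 * r \<and> card W \<le> 4 * (k - r) + 4 \<and>
     u \<in> fixed_points n p \<and> v \<in> fixed_points n p \<and> u \<noteq> v \<and> {u, v} \<in> free_edges n h)"

text \<open>Here \<open>W\<close> is empty, so Maker's edges are exactly the matching edges and none
  joins two unmatched vertices. Two disjoint \<open>k\<close>-sets of unmatched vertices therefore
  have a free edge between them.\<close>

lemma idle_step_many:
  assumes idle: "idle_state n k (Suc r) h" and r: "k \<le> r"
    and sparse: "sparse_breaker n k d (set (snd h))"
  shows "\<exists>e\<in>free_edges n h. idle_state n k r (fst h @ [e], snd h)"
proof -
  obtain p W where st: "matching_state n p W (set (fst h))"
    and card: "card (fixed_points n p) = 2 * Suc r" and W: "card W \<le> 4 * (k - Suc r)"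
    using idle by (auto simp: idle_state_def)
  have W0: "W = {}" using W r st by (auto simp: matching_state_def)
  obtain X where X: "X \<subseteq> fixed_points n p" "card X = k"
    using obtain_subset_with_card_n[of k "fixed_points n p"] card r by auto
  have "card (fixed_points n p - X) \<ge> k"
    using X card r by (subst card_Diff_subset) (auto intro: finite_subset)
  then obtain Y where Y: "Y \<subseteq> fixed_points n p - X" "card Y = k"
    by (rule obtain_subset_with_card_n)
  have "X \<subseteq> {..<n}" "Y \<subseteq> {..<n}" "X \<inter> Y = {}"
    using X(1) Y(1) by (auto simp: fixed_points_def)
  then obtain u v where uv: "u \<in> X" "v \<in> Y" "{u, v} \<notin> set (snd h)"
    using sparse_breaker_pair[OF sparse _ _ _ X(2) Y(2)] by blast
  have fx: "u \<in> fixed_points n p" "v \<in> fixed_points n p" "u \<noteq> v" using uv X Y by auto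
  have "{u, v} \<notin> set (fst h)"
  proof
    assume "{u, v} \<in> set (fst h)"
    then obtain z where "z < n" "p z \<noteq> z" "{u, v} = {z, p z}"
      using st W0 unfolding matching_state_def by (metis empty_not_insert subset_empty)
    then show False using fx by (auto simp: fixed_points_def doubleton_eq_iff)
  qed
  then have "{u, v} \<in> free_edges n h"
    using uv(3) fx doubleton_in_board[of u n v] by (simp add: free_edges_def fixed_points_def)
  moreover have "idle_state n k r (fst h @ [{u, v}], snd h)"
  proof -
    have "card (fixed_points n p - {u, v}) = 2 * r" using fx card by (subst card_Diff_subset) auto
    then show ?thesis
      unfolding idle_state_def using matching_state_join[OF st fx] W0
      by (intro exI[of _ "p(u := v, v := u)"] exI[of _ W]) simp
  qed
  ultimately show ?thesis by blast
qed

text \<open>The four extra vertices allowed in \<open>W\<close> are absorbed by the decrease of the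
  number of pairs; \<open>Suc r \<le> k\<close> ensures that the subtraction is not
  truncated.\<close>

lemma closing_step:
  assumes "closing_state n k (Suc r) h" "Suc r \<le> k"
  shows "\<exists>e\<in>free_edges n h. idle_state n k r (fst h @ [e], snd h)"
proof -
  obtain p W u v where st: "matching_state n p W (set (fst h))"
    and card: "card (fixed_points n p) = 2 * Suc r" and W: "card W \<le> 4 * (k - Suc r) + 4"
    and fx: "u \<in> fixed_points n p" "v \<in> fixed_points n p" "u \<noteq> v" and free: "{u, v} \<in> free_edges n h"
    using assms(1) by (auto simp: closing_state_def)
  have "card (fixed_points n p - {u, v}) = 2 * r" using fx card by (subst card_Diff_subset) auto
  moreover have "card W \<le> 4 * (k - r)" using W assms(2) by simp
  ultimately have "idle_state n k r (fst h @ [{u, v}], snd h)"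
    unfolding idle_state_def using matching_state_join[OF st fx]
    by (intro exI[of _ "p(u := v, v := u)"] exI[of _ W]) simp
  with free show ?thesis by blast
qed

text \<open>Claiming \<open>{u, x}\<close> already allows the rotation. Then \<open>y\<close>
  replaces \<open>u\<close> as an unmatched vertex, and the edge \<open>{v, y}\<close> alone remains
  to be claimed.\<close>

lemma linked_step:
  assumes "linked_state n k r h"
  shows "\<exists>e\<in>free_edges n h. closing_state n k r (fst h @ [e], snd h)"
proof -
  obtain p W u v x y where st: "matching_state n p W (set (fst h))"
    and card: "card (fixed_points n p) = 2 * r" and W: "card W \<le> 4 * (k - r) + 4"
    and fx: "u \<in> fixed_points n p" "v \<in> fixed_points n p" "u \<noteq> v"
    and xy: "x < n" "y < n" "p x \<noteq> x" "p y \<noteq> y" "x \<noteq> y" "x \<noteq> p y" "{x, p x, y, p y} \<subseteq> W"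
      "{p x, p y} \<in> set (fst h)"
    and free: "{u, x} \<in> free_edges n h" "{v, y} \<in> free_edges n h"
    using assms by (auto simp: linked_state_def)
  define p' where "p' = p(u := x, x := u, p x := p y, p y := p x, y := y)"
  note rot = matching_state_rotate[OF st fx(1) xy, folded p'_def]
  have y: "y \<notin> fixed_points n p" "v \<noteq> y" "u \<noteq> y"
    using xy fx by (auto simp: fixed_points_def)
  have "card (fixed_points n p) > 0" using fx by (auto simp: card_gt_0_iff)
  then have "card (fixed_points n p') = 2 * r" using y card fx by (simp add: rot(2))
  moreover have "{v, y} \<in> free_edges n (fst h @ [{u, x}], snd h)"
    using free fx(3) y by (auto simp: free_edges_maker doubleton_eq_iff)
  moreover have "v \<in> fixed_points n p'" "y \<in> fixed_points n p'" using fx rot(2) by auto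
  ultimately have "closing_state n k r (fst h @ [{u, x}], snd h)"
    unfolding closing_state_def using rot(1) W y
    by (intro exI[of _ p'] exI[of _ W] exI[of _ v] exI[of _ y]) simp
  with free show ?thesis by blast
qed

lemma idle_step_few:
  assumes idle: "idle_state n k r h" and r: "0 < r" "r \<le> k"
    and sparse: "sparse_breaker n k (13 * k) (set (snd h))"
  shows "\<exists>e\<in>free_edges n h. linked_state n k r (fst h @ [e], snd h)"
proof -
  obtain p W where st: "matching_state n p W (set (fst h))"
    and card: "card (fixed_points n p) = 2 * r" and W: "card W \<le> 4 * (k - r)"
    using idle by (auto simp: idle_state_def)
  note st' = st[unfolded matching_state_def]
  let ?B = "set (snd h)"
  define F where "F = fixed_points n p"
  have finW: "finite W" using st' by simp
  have "card F \<ge> 2" using card r by (simp add: F_def)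
  then obtain u v where uv: "u \<in> F" "v \<in> F" "u \<noteq> v"
    using card_le_Suc_iff[of 1 F] by (auto simp: numeral_2_eq_2 card_le_Suc_iff)
  have fx: "u < n" "v < n" "p u = u" "p v = v" using uv by (auto simp: F_def fixed_points_def)
  \<comment> \<open>Candidates for the inner path vertex on the side of \<open>w\<close>: the path
    is \<open>u, p a, a, c, p c, v\<close> with \<open>a\<close> in \<open>A u\<close> and
    \<open>c\<close> in \<open>A v\<close>.\<close>
  define A where "A w = {z. z < n \<and> p z \<noteq> z \<and> z \<notin> W \<and> p z \<notin> W \<and> {w, p z} \<notin> ?B}" for w
  \<comment> \<open>From the \<open>13 * k\<close> vertices not joined to \<open>w\<close> by
    Breaker, at most \<open>2 * r + 8 * (k - r) \<le> 8 * k\<close> are removed. The value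
    \<open>3 * k\<close> suffices for \<open>k\<close> vertices after \<open>X\<close> and
    \<open>p\<close> applied to \<open>X\<close> have been excluded.\<close>
  have A_card: "3 * k \<le> card (A w)" if "w < n" for w
  proof -
    define N where "N = {z. z < n \<and> z \<noteq> w \<and> {w, z} \<notin> ?B}"
    have "13 * k \<le> card N" using sparse that by (simp add: sparse_breaker_def N_def)
    moreover have "card (F \<union> W \<union> p ` W) \<le> card F + card W + card W"
      using card_Un_le[of "F \<union> W" "p ` W"] card_Un_le[of F W] card_image_le[OF finW, of p] by simp
    moreover have "card N - card (F \<union> W \<union> p ` W) \<le> card (N - (F \<union> W \<union> p ` W))"
      by (rule diff_card_le_card_Diff) (simp add: F_def finW)
    ultimately have "3 * k \<le> card (N - (F \<union> W \<union> p ` W))"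
      using card W r by (simp add: F_def)
    also have "\<dots> = card (p ` (N - (F \<union> W \<union> p ` W)))"
    proof (rule card_image[symmetric], rule inj_onI)
      fix a b assume "a \<in> N - (F \<union> W \<union> p ` W)" "b \<in> N - (F \<union> W \<union> p ` W)" "p a = p b"
      then show "a = b" using st' by (auto simp: N_def) metis
    qed
    also have "\<dots> \<le> card (A w)"
    proof (rule card_mono)
      show "p ` (N - (F \<union> W \<union> p ` W)) \<subseteq> A w"
      proof (rule subsetI, elim imageE DiffE)
        fix c z assume c: "c = p z" and "z \<in> N" "z \<notin> F \<union> W \<union> p ` W"
        then have z: "z \<in> N" "z \<notin> F" "z \<notin> W" "z \<notin> p ` W" by simp_all
        have zn: "z < n" "p z \<noteq> z" using z by (auto simp: N_def F_def fixed_points_def)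
        then have pz: "p (p z) = z" "p z < n" using st' by auto
        moreover have "p z \<notin> W" using z(4) pz(1) by (metis imageI)
        ultimately show "c \<in> A w" using z zn by (auto simp: c A_def N_def)
      qed
    qed (simp add: A_def)
    finally show ?thesis .
  qed
  have finA: "finite (A w)" for w by (simp add: A_def)
  obtain X where X: "X \<subseteq> A u" "card X = k"
    using obtain_subset_with_card_n[of k "A u"] A_card[OF fx(1)] by auto
  have finX: "finite X" using X(1) finA finite_subset by blast
  have "card (X \<union> p ` X) \<le> 2 * k"
    using card_Un_le[of X "p ` X"] card_image_le[OF finX, of p] X(2) by simp
  \<comment> \<open>Avoiding \<open>X\<close> and its partners makes \<open>{a, p a}\<close> and
    \<open>{c, p c}\<close> different matching edges.\<close>
  then have "k \<le> card (A v - (X \<union> p ` X))"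
    using diff_card_le_card_Diff[of "X \<union> p ` X" "A v"] A_card[OF fx(2)] finX by simp
  then obtain Y where Y: "Y \<subseteq> A v - (X \<union> p ` X)" "card Y = k"
    by (rule obtain_subset_with_card_n)
  have "X \<subseteq> {..<n}" "Y \<subseteq> {..<n}" "X \<inter> Y = {}" using X(1) Y(1) by (auto simp: A_def)
  then obtain a c where ac: "a \<in> X" "c \<in> Y" "{a, c} \<notin> ?B"
    using sparse_breaker_pair[OF sparse _ _ _ X(2) Y(2)] by blast
  have a: "a < n" "p a \<noteq> a" "a \<notin> W" "p a \<notin> W" "{u, p a} \<notin> ?B" "p a < n" "p (p a) = a"
    using ac(1) X(1) st' by (auto simp: A_def)
  have c: "c < n" "p c \<noteq> c" "c \<notin> W" "p c \<notin> W" "{v, p c} \<notin> ?B" "p c < n" "p (p c) = c"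
    using ac(2) Y(1) st' by (auto simp: A_def)
  have "c \<notin> X" "c \<notin> p ` X" using ac(2) Y(1) by auto
  then have ne: "a \<noteq> c" "c \<noteq> p a" "a \<noteq> p c" using ac(1) c(7) by (blast, blast, metis imageI)
  have "p a \<noteq> p c" using a(7) c(7) ne by metis
  have not_maker: "e \<notin> set (fst h)" if "\<not> e \<subseteq> W" "\<And>z. z < n \<Longrightarrow> p z \<noteq> z \<Longrightarrow> e \<noteq> {z, p z}" for e
    using st' that by blast
  have "{a, c} \<notin> set (fst h)"
    using a c ne by (intro not_maker) (auto simp: doubleton_eq_iff)
  moreover have "{u, p a} \<notin> set (fst h)"
    using a fx by (intro not_maker) (auto simp: doubleton_eq_iff)
  moreover have "{v, p c} \<notin> set (fst h)"
    using c fx by (intro not_maker) (auto simp: doubleton_eq_iff)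
  moreover have "u \<noteq> p a" "v \<noteq> p c" "u \<noteq> a" "u \<noteq> c" "v \<noteq> a" "v \<noteq> c" using fx a c by auto
  ultimately have free: "{a, c} \<in> free_edges n h" "{u, p a} \<in> free_edges n h" "{v, p c} \<in> free_edges n h"
    using a c ac ne fx by (auto simp: free_edges_def doubleton_in_board)
  \<comment> \<open>The rotation will discard the two matching edges, and the new edge
    \<open>{a, c}\<close> is not yet in the matching; all three must lie inside the new
    \<open>W'\<close>.\<close>
  define W' where "W' = {p a, a, p c, c} \<union> W"
  have "card {p a, a, p c, c} \<le> 4" by (simp add: card_insert_if)
  then have W': "card W' \<le> 4 * (k - r) + 4"
    using card_Un_le[of "{p a, a, p c, c}" W] W by (simp add: W'_def)
  have st2: "matching_state n p W' (set (fst (fst h @ [{a, c}], snd h)))"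
    using st' unfolding matching_state_def
    by (simp add: W'_def) (meson insertI2 subset_insertI2)
  have "{u, p a} \<noteq> {a, c}" "{v, p c} \<noteq> {a, c}"
    using \<open>u \<noteq> a\<close> \<open>u \<noteq> c\<close> \<open>v \<noteq> a\<close> \<open>v \<noteq> c\<close> by (auto simp: doubleton_eq_iff)
  then have free': "{u, p a} \<in> free_edges n (fst h @ [{a, c}], snd h)"
    "{v, p c} \<in> free_edges n (fst h @ [{a, c}], snd h)"
    using free by (simp_all add: free_edges_maker)
  have "linked_state n k r (fst h @ [{a, c}], snd h)"
    unfolding linked_state_def
    by (rule exI[of _ p], rule exI[of _ W'], rule exI[of _ u], rule exI[of _ v],
        rule exI[of _ "p a"], rule exI[of _ "p c"])
       (use st2 card W' uv a c ne \<open>p a \<noteq> p c\<close> free' in \<open>auto simp: F_def W'_def\<close>)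
  with free(1) show ?thesis by blast
qed

section \<open>The damage done by one turn of Breaker\<close>

lemma free_after_breaker_turn:
  assumes "h' \<in> set_pmf (random_breaker_turn n b h)" "e \<in> free_edges n h" "e \<notin> set (snd h')"
  shows "e \<in> free_edges n h'"
  using assms random_breaker_turn_support(1)[OF assms(1)] by (auto simp: free_edges_def)

text \<open>Breaker can destroy \<open>Q\<close> only by claiming one of the reserved edges in
  \<open>J\<close>, and a union bound over \<open>J\<close> applies.\<close>

lemma prob_breaker_turn_le:
  assumes m: "0 < m" "m + b \<le> card (free_edges n h)" and J: "finite J" "J \<subseteq> free_edges n h"
    and Q: "\<And>h'. fst h' = fst h \<Longrightarrow> J \<subseteq> free_edges n h' \<Longrightarrow> Q h'"
  shows "measure_pmf.prob (random_breaker_turn n b h) {h'. \<not> Q h'} \<le> real (card J) * (real b / real m)"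
proof -
  let ?M = "random_breaker_turn n b h"
  have "measure_pmf.prob ?M {h'. \<not> Q h'} \<le> measure_pmf.prob ?M (\<Union>e\<in>J. {h'. e \<in> set (snd h')})"
  proof (rule measure_pmf.finite_measure_mono_AE, unfold AE_measure_pmf_iff, intro ballI impI)
    fix h' assume h': "h' \<in> set_pmf ?M" "h' \<in> {h'. \<not> Q h'}"
    show "h' \<in> (\<Union>e\<in>J. {h'. e \<in> set (snd h')})"
    proof (rule ccontr)
      assume "h' \<notin> (\<Union>e\<in>J. {h'. e \<in> set (snd h')})"
      then have "J \<subseteq> free_edges n h'" using free_after_breaker_turn[OF h'(1)] J(2) by auto
      then show False using Q[of h'] h' random_breaker_turn_support(1)[OF h'(1)] by simp
    qed
  qed auto
  also have "\<dots> \<le> (\<Sum>e\<in>J. measure_pmf.prob ?M {h'. e \<in> set (snd h')})"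
    using J(1) by (intro measure_pmf.finite_measure_subadditive_finite) auto
  also have "\<dots> \<le> (\<Sum>e\<in>J. real b / real m)"
    using J(2) m by (intro sum_mono prob_breaker_turn_claims) auto
  finally show ?thesis by simp
qed

text \<open>The argument \<open>q\<close> is the number of rounds left: one round per unmatched pair as long as there
  are more than \<open>k\<close> pairs, then three rounds per pair.\<close>
definition pm_invariant :: "nat \<Rightarrow> nat \<Rightarrow> nat \<Rightarrow> history \<Rightarrow> bool" where
  "pm_invariant n k q h =
     (if 3 * k \<le> q then idle_state n k (q - 2 * k) h
      else if q mod 3 = 0 then idle_state n k (q div 3) h
      else if q mod 3 = 2 then linked_state n k (q div 3 + 1) h
      else closing_state n k (q div 3 + 1) h)"

text \<open>In the last \<open>3 * k\<close> rounds the number of rounds left runs through the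
  residues \<open>0\<close>, \<open>2\<close>, \<open>1\<close> modulo \<open>3\<close>, which mark
  the positions before the first, second and third edge of an augmentation.\<close>

lemma pm_invariant_maker:
  assumes inv: "pm_invariant n k (Suc q) h" and sparse: "sparse_breaker n k (13 * k) (set (snd h))"
  shows "\<exists>e\<in>free_edges n h. pm_invariant n k q (fst h @ [e], snd h)"
proof (cases "3 * k \<le> q")
  case True
  then have "idle_state n k (Suc (q - 2 * k)) h"
    using inv by (simp add: pm_invariant_def Suc_diff_le)
  from idle_step_many[OF this _ sparse] True show ?thesis by (simp add: pm_invariant_def)
next
  case False
  have "q = 3 * (q div 3) + 2 \<or> q = 3 * (q div 3) + 1 \<or> q = 3 * (q div 3)" by presburger
  then consider (a) r where "q = 3 * r + 2" | (b) r where "q = 3 * r + 1" | (c) r where "q = 3 * r"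
    by blast
  then show ?thesis
  proof cases
    case (a r)
    have q: "Suc q = 3 * Suc r" "q mod 3 = 2" "q div 3 = r" "Suc q div 3 = Suc r" using a by presburger+
    have "idle_state n k (Suc r) h"
    proof (cases "3 * k \<le> Suc q")
      \<comment> \<open>On the boundary \<open>Suc q = 3 * k\<close> both descriptions give the same
        number \<open>k\<close> of unmatched pairs.\<close>
      case True
      then have "k = Suc r" using False q(1) by presburger
      then have "Suc q - 2 * k = Suc r" using q(1) by simp
      with True inv show ?thesis by (simp only: pm_invariant_def if_True)
    next
      case False
      with inv q show ?thesis by (simp add: pm_invariant_def)
    qed
    from idle_step_few[OF this _ _ sparse] False q show ?thesis by (simp add: pm_invariant_def)
  next
    case (b r)
    have q: "Suc q mod 3 = 2" "q mod 3 = 1" "q div 3 = r" "Suc q div 3 = r" "\<not> 3 * k \<le> Suc q"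
      using b False by presburger+
    then have "linked_state n k (Suc r) h" using inv by (simp add: pm_invariant_def)
    from linked_step[OF this] False q show ?thesis by (simp add: pm_invariant_def)
  next
    case (c r)
    have q: "Suc q mod 3 = 1" "q mod 3 = 0" "q div 3 = r" "Suc q div 3 = r" "\<not> 3 * k \<le> Suc q"
      using c False by presburger+
    then have "closing_state n k (Suc r) h" using inv by (simp add: pm_invariant_def)
    from closing_step[OF this] False q c show ?thesis by (simp add: pm_invariant_def)
  qed
qed

text \<open>An idle position depends on Maker's edges only. A linked position reserves two edges and
  a closing one a single edge, so \<open>2\<close> covers both.\<close>

lemma pm_invariant_breaker:
  assumes inv: "pm_invariant n k q h" and m: "0 < m" "m + b \<le> card (free_edges n h)"
  shows "measure_pmf.prob (random_breaker_turn n b h) {h'. \<not> pm_invariant n k q h'}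
    \<le> (if 3 * k \<le> q then 0 else 2 * (real b / real m))"
proof -
  obtain J where J: "finite J" "J \<subseteq> free_edges n h" "card J \<le> (if 3 * k \<le> q then 0 else 2)"
    and inv': "\<And>h'. fst h' = fst h \<Longrightarrow> J \<subseteq> free_edges n h' \<Longrightarrow> pm_invariant n k q h'"
  proof (cases "3 * k \<le> q \<or> q mod 3 = 0")
    case True
    show thesis
      by (rule that[of "{}"]) (use True inv in \<open>auto simp: pm_invariant_def idle_state_def\<close>)
  next
    case False
    show thesis
    proof (cases "q mod 3 = 2")
      case True
      with False inv have "linked_state n k (q div 3 + 1) h" by (simp add: pm_invariant_def)
      then obtain u v x y where *: "{u, x} \<in> free_edges n h" "{v, y} \<in> free_edges n h"
        and **: "\<And>h'. fst h' = fst h \<Longrightarrow> {u, x} \<in> free_edges n h' \<Longrightarrow> {v, y} \<in> free_edges n h' \<Longrightarrow>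
          linked_state n k (q div 3 + 1) h'"
        unfolding linked_state_def by metis
      show thesis
        by (rule that[of "{{u, x}, {v, y}}"])
          (use False True * ** in \<open>auto simp: pm_invariant_def card_insert_if\<close>)
    next
      case F2: False
      with False inv have "closing_state n k (q div 3 + 1) h" by (simp add: pm_invariant_def)
      then obtain u v where *: "{u, v} \<in> free_edges n h"
        and **: "\<And>h'. fst h' = fst h \<Longrightarrow> {u, v} \<in> free_edges n h' \<Longrightarrow>
          closing_state n k (q div 3 + 1) h'"
        unfolding closing_state_def by metis
      show thesis
        by (rule that[of "{{u, v}}"]) (use False F2 * ** in \<open>auto simp: pm_invariant_def\<close>)
    qed
  qed
  have "measure_pmf.prob (random_breaker_turn n b h) {h'. \<not> pm_invariant n k q h'}
      \<le> real (card J) * (real b / real m)"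
    by (rule prob_breaker_turn_le[OF m J(1,2) inv'])
  also have "\<dots> \<le> real (if 3 * k \<le> q then 0 else 2) * (real b / real m)"
    by (intro mult_right_mono of_nat_mono J(3)) auto
  finally show ?thesis by (simp split: if_splits)
qed

text \<open>The round count consists of \<open>n div 2 - k\<close> direct moves and
  \<open>3 * k\<close> moves for the last \<open>k\<close> pairs.\<close>

lemma pm_invariant_start:
  assumes "even n" "k \<le> n div 2"
  shows "pm_invariant n k (n div 2 + 2 * k) ([], [])"
proof -
  have "matching_state n id {} {}" by (simp add: matching_state_def)
  moreover have "fixed_points n id = {..<n}" by (auto simp: fixed_points_def)
  ultimately have "idle_state n k (n div 2) ([], [])"
    unfolding idle_state_def using assms(1) by (intro exI[of _ id] exI[of _ "{}"]) simp
  then show ?thesis using assms(2) by (simp add: pm_invariant_def)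
qed

lemma pm_invariant_end:
  assumes "pm_invariant n k 0 h"
  shows "maker_wins (perfect_matchings n) h"
proof -
  obtain p W where st: "matching_state n p W (set (fst h))" and "card (fixed_points n p) = 0"
    using assms by (auto simp: pm_invariant_def idle_state_def split: if_splits)
  then have "fixed_points n p = {}" by simp
  then have p: "p x < n" "p (p x) = x" "p x \<noteq> x" "{x, p x} \<in> set (fst h)" if "x < n" for x
    using st that by (auto simp: matching_state_def fixed_points_def)
  define M where "M = (\<lambda>x. {x, p x}) ` {..<n}"
  have "M \<subseteq> board n" unfolding M_def using p doubleton_in_board by fastforce
  moreover have "\<exists>!e. e \<in> M \<and> v \<in> e" if "v < n" for v
  proof (rule ex1I[of _ "{v, p v}"])
    fix e assume "e \<in> M \<and> v \<in> e"
    then obtain x where x: "x < n" "e = {x, p x}" "v \<in> {x, p x}" by (auto simp: M_def)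
    then show "e = {v, p v}" using p(2)[of x] by auto
  qed (use that in \<open>auto simp: M_def\<close>)
  ultimately have "M \<in> perfect_matchings n" by (simp add: perfect_matchings_def)
  moreover have "M \<subseteq> set (fst h)" using p(4) by (auto simp: M_def)
  ultimately show ?thesis by (auto simp: maker_wins_def)
qed

text \<open>The last summand accounts for the free edges that Maker reserves in at most \<open>3 k\<close> rounds.\<close>
definition error_bound :: "nat \<Rightarrow> nat \<Rightarrow> nat \<Rightarrow> nat \<Rightarrow> real" where
  "error_bound n k b m = (let x = 1 - real m / real (card (board n)) in
     real n ^ (2 * k) * x ^ (k * k) + real n ^ (13 * k + 1) * x ^ (n - 13 * k) +
     6 * real k * (real b / real m))"

lemma perfect_matching_strategy:
  assumes "even n" "k \<le> n div 2" "13 * k \<le> n" "0 < m"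
    "m + (n div 2 + 2 * k) * (b + 1) \<le> card (board n)"
  shows "\<exists>S. legal_strategy n S \<and>
    measure_pmf.prob (half_random_play n b S (n div 2 + 2 * k))
      {h. \<not> maker_wins (perfect_matchings n) h} \<le> error_bound n k b m"
proof -
  define T where "T = n div 2 + 2 * k"
  \<comment> \<open>After Maker's move in round \<open>t\<close>, \<open>T - Suc t\<close> rounds
    are left; edges are reserved only when this is below \<open>3 * k\<close>, hence in the last
    \<open>3 * k\<close> rounds.\<close>
  define \<beta> where "\<beta> t = (if t < T - 3 * k then 0 else 2 * (real b / real m))" for t
  have T: "3 * k \<le> T" using assms(2) by (simp add: T_def)
  obtain S where S: "legal_strategy n S"
    and le: "measure_pmf.prob (half_random_play n b S T) {h. \<not> pm_invariant n k (T - T) h}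
      \<le> measure_pmf.prob (half_random_play n b S T)
          {h. \<not> sparse_breaker n k (13 * k) (set (snd h))} + (\<Sum>t<T. \<beta> t)"
  proof (rule strategy_from_invariant[where P = "\<lambda>t. pm_invariant n k (T - t)" and T = T and n = n
        and G = "sparse_breaker n k (13 * k)" and m = m and b = b and \<beta> = \<beta>])
    show "pm_invariant n k (T - 0) ([], [])"
      using pm_invariant_start[OF assms(1,2)] by (simp add: T_def)
    show "\<exists>e\<in>free_edges n h. pm_invariant n k (T - Suc t) (fst h @ [e], snd h)"
      if "t < T" "pm_invariant n k (T - t) h" "sparse_breaker n k (13 * k) (set (snd h))" for t h
      using pm_invariant_maker[of n k "T - Suc t" h] that by (simp add: Suc_diff_Suc)
    show "measure_pmf.prob (random_breaker_turn n b h) {h'. \<not> pm_invariant n k (T - Suc t) h'} \<le> \<beta> t"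
      if "t < T" "pm_invariant n k (T - Suc t) h" "m + b \<le> card (free_edges n h)" for t h
    proof -
      have "3 * k \<le> T - Suc t \<longleftrightarrow> t < T - 3 * k" using that(1) T by auto
      then show ?thesis using pm_invariant_breaker[OF that(2) assms(4) that(3)] by (simp add: \<beta>_def)
    qed
    show "sparse_breaker n k (13 * k) B" if "sparse_breaker n k (13 * k) B'" "B \<subseteq> B'" for B B'
      using sparse_breaker_antimono that .
  qed (use assms in \<open>auto simp: \<beta>_def T_def\<close>)
  have "(\<Sum>t<T. \<beta> t) = (\<Sum>t\<in>{T - 3 * k..<T}. 2 * (real b / real m))"
    unfolding \<beta>_def by (intro sum.mono_neutral_cong_right) auto
  also have "\<dots> = 6 * real k * (real b / real m)" using T by (simp add: of_nat_diff)
  finally have sum: "(\<Sum>t<T. \<beta> t) = 6 * real k * (real b / real m)" .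
  have "measure_pmf.prob (half_random_play n b S T) {h. \<not> maker_wins (perfect_matchings n) h}
      \<le> measure_pmf.prob (half_random_play n b S T) {h. \<not> pm_invariant n k (T - T) h}"
    using pm_invariant_end by (intro measure_pmf.finite_measure_mono) auto
  also note le
  also note sum
  also have "measure_pmf.prob (half_random_play n b S T)
        {h. \<not> sparse_breaker n k (13 * k) (set (snd h))} + 6 * real k * (real b / real m)
      \<le> error_bound n k b m"
    using prob_not_sparse_breaker[OF S assms(4) assms(5)[folded T_def] assms(3), of k]
    by (simp add: error_bound_def Let_def)
  finally show ?thesis using S unfolding T_def by blast
qed


section \<open>The minimum degree game\<close>

text \<open>The intersection with the board is taken because an arbitrary history may list sets that
  are not edges, whereas a winning graph must lie on the board.\<close>

definition isolated :: "nat \<Rightarrow> edge set \<Rightarrow> nat set" where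
  "isolated n E = {v. v < n \<and> (\<forall>e\<in>E \<inter> board n. v \<notin> e)}"

lemma finite_isolated [simp]: "finite (isolated n E)"
  by (simp add: isolated_def)

lemma isolated_insert: "e \<in> board n \<Longrightarrow> isolated n (insert e E) = isolated n E - e"
  by (auto simp: isolated_def)

lemma maker_wins_min_degree:
  assumes "isolated n (set (fst h)) = {}"
  shows "maker_wins (min_degree_one_graphs n) h"
proof -
  let ?E = "set (fst h) \<inter> board n"
  have "1 \<le> vertex_degree ?E v" if "v < n" for v
  proof -
    have "{e \<in> ?E. v \<in> e} \<noteq> {}" using assms that by (auto simp: isolated_def)
    then have "0 < card {e \<in> ?E. v \<in> e}" by (subst card_gt_0_iff) auto
    then show ?thesis by (simp add: vertex_degree_def)
  qed
  then have "?E \<in> min_degree_one_graphs n" by (simp add: min_degree_one_graphs_def)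
  then show ?thesis by (auto simp: maker_wins_def)
qed

text \<open>The three alternatives describe the phase in which every move has covered two new
  vertices, the phase in which one new vertex per move suffices to finish within
  \<open>n div 2 + 2 * k\<close> moves, and the won position.\<close>

definition md_invariant :: "nat \<Rightarrow> nat \<Rightarrow> nat \<Rightarrow> history \<Rightarrow> bool" where
  "md_invariant n k t h \<longleftrightarrow> (let i = card (isolated n (set (fst h))) in
     2 * t + i \<le> n \<or> t + i \<le> n div 2 + 2 * k \<or> i = 0)"

lemma md_invariant_maker:
  assumes inv: "md_invariant n k t h" and sparse: "sparse_breaker n k (13 * k) (set (snd h))"
    and k: "0 < k" and ne: "free_edges n h \<noteq> {}"
  shows "\<exists>e\<in>free_edges n h. md_invariant n k (Suc t) (fst h @ [e], snd h)"
proof -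
  define I where "I = isolated n (set (fst h))"
  have finI: "finite I" by (simp add: I_def)
  have In: "I \<subseteq> {..<n}" by (auto simp: I_def isolated_def)
  have iso: "isolated n (set (fst (fst h @ [e], snd h))) = I - e" if "e \<in> free_edges n h" for e
    using isolated_insert[of e n "set (fst h)"] that by (simp add: I_def free_edges_def)
  \<comment> \<open>Maker has no edge at an isolated vertex, so an edge there that is not Breaker's
    is free.\<close>
  have free: "{x, y} \<in> free_edges n h" if "x \<in> I" "y < n" "x \<noteq> y" "{x, y} \<notin> set (snd h)" for x y
    using that doubleton_in_board[of x n y] by (auto simp: I_def isolated_def free_edges_def)
  \<comment> \<open>With fewer than \<open>2 * k\<close> isolated vertices, the first alternative
    implies the second, since \<open>t + i \<le> (n + i) / 2\<close>.\<close>
  consider (none) "I = {}" | (many) "2 * t + card I \<le> n" "2 * k \<le> card I"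
    | (few) "I \<noteq> {}" "t + card I \<le> n div 2 + 2 * k"
    using inv finI unfolding md_invariant_def Let_def I_def[symmetric] by fastforce
  then show ?thesis
  proof cases
    case none
    then show ?thesis using ne iso by (auto simp: md_invariant_def)
  next
    case many
    obtain X where X: "X \<subseteq> I" "card X = k"
      using obtain_subset_with_card_n[of k I] many(2) by auto
    have "card (I - X) \<ge> k"
      using X many(2) finite_subset[OF X(1) finI] by (subst card_Diff_subset) auto
    then obtain Y where Y: "Y \<subseteq> I - X" "card Y = k"
      by (rule obtain_subset_with_card_n)
    have "X \<subseteq> {..<n}" "Y \<subseteq> {..<n}" "X \<inter> Y = {}" using X(1) Y(1) In by auto
    then obtain x y where xy: "x \<in> X" "y \<in> Y" "{x, y} \<notin> set (snd h)"
      using sparse_breaker_pair[OF sparse _ _ _ X(2) Y(2)] by blast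
    have xy': "x \<in> I" "y \<in> I" "x \<noteq> y" using xy X Y by auto
    then have e: "{x, y} \<in> free_edges n h" using free xy In by auto
    have "card (I - {x, y}) = card I - 2" using xy' by (subst card_Diff_subset) auto
    then have "2 * Suc t + card (I - {x, y}) \<le> n" using many k by arith
    then have "md_invariant n k (Suc t) (fst h @ [{x, y}], snd h)"
      unfolding md_invariant_def Let_def iso[OF e] by blast
    with e show ?thesis by blast
  next
    case few
    then obtain x where x: "x \<in> I" by auto
    then have "x < n" using In by auto
    then have "0 < card {w. w < n \<and> w \<noteq> x \<and> {x, w} \<notin> set (snd h)}"
      using sparse k by (auto simp: sparse_breaker_def)
    then obtain y where y: "y < n" "x \<noteq> y" "{x, y} \<notin> set (snd h)"
      by (auto simp: card_gt_0_iff)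
    have e: "{x, y} \<in> free_edges n h" using free x y by auto
    have "card (I - {x, y}) < card I" using x finI by (intro psubset_card_mono) auto
    then have "md_invariant n k (Suc t) (fst h @ [{x, y}], snd h)"
      unfolding md_invariant_def Let_def iso[OF e] using few by simp
    with e show ?thesis by blast
  qed
qed

lemma min_degree_strategy:
  assumes "13 * k \<le> n" "0 < k" "0 < m" "m + (n div 2 + 2 * k) * (b + 1) \<le> card (board n)"
  shows "\<exists>S. legal_strategy n S \<and>
    measure_pmf.prob (half_random_play n b S (n div 2 + 2 * k))
      {h. \<not> maker_wins (min_degree_one_graphs n) h} \<le> error_bound n k b m"
proof -
  define T where "T = n div 2 + 2 * k"
  obtain S where S: "legal_strategy n S"
    and le: "measure_pmf.prob (half_random_play n b S T) {h. \<not> md_invariant n k T h}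
      \<le> measure_pmf.prob (half_random_play n b S T)
          {h. \<not> sparse_breaker n k (13 * k) (set (snd h))} + (\<Sum>t<T. 0)"
  proof (rule strategy_from_invariant[where P = "md_invariant n k" and T = T and n = n
        and G = "sparse_breaker n k (13 * k)" and m = m and b = b and \<beta> = "\<lambda>_. 0"])
    have "isolated n {} = {..<n}" by (auto simp: isolated_def)
    then show "md_invariant n k 0 ([], [])" by (simp add: md_invariant_def)
    show "\<exists>e\<in>free_edges n h. md_invariant n k (Suc t) (fst h @ [e], snd h)"
      if "t < T" "md_invariant n k t h" "sparse_breaker n k (13 * k) (set (snd h))"
        "free_edges n h \<noteq> {}" for t h
      using md_invariant_maker that assms(2) by blast
    show "measure_pmf.prob (random_breaker_turn n b h) {h'. \<not> md_invariant n k (Suc t) h'} \<le> 0"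
      if "md_invariant n k (Suc t) h" "m + b \<le> card (free_edges n h)" for t h
      using prob_breaker_turn_le[OF assms(3) that(2), of "{}" "md_invariant n k (Suc t)"] that(1)
      by (simp add: md_invariant_def)
    show "sparse_breaker n k (13 * k) B" if "sparse_breaker n k (13 * k) B'" "B \<subseteq> B'" for B B'
      using sparse_breaker_antimono that .
  qed (use assms in \<open>auto simp: T_def\<close>)
  have "maker_wins (min_degree_one_graphs n) h" if "md_invariant n k T h" for h
  proof -
    \<comment> \<open>After \<open>T\<close> rounds the first alternative would need
      \<open>2 * T \<le> n\<close>, impossible for \<open>k > 0\<close>; each of the other two
      leaves no isolated vertex.\<close>
    have "card (isolated n (set (fst h))) = 0"
      using that assms(2) unfolding md_invariant_def Let_def T_def by presburger
    then show ?thesis by (intro maker_wins_min_degree) simp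
  qed
  then have "measure_pmf.prob (half_random_play n b S T) {h. \<not> maker_wins (min_degree_one_graphs n) h}
      \<le> measure_pmf.prob (half_random_play n b S T) {h. \<not> md_invariant n k T h}"
    by (intro measure_pmf.finite_measure_mono) auto
  also note le
  also have "measure_pmf.prob (half_random_play n b S T)
        {h. \<not> sparse_breaker n k (13 * k) (set (snd h))} + (\<Sum>t<T. 0)
      \<le> error_bound n k b m"
  proof -
    have "0 \<le> 6 * real k * (real b / real m)" by simp
    then show ?thesis
      using prob_not_sparse_breaker[OF S assms(3) assms(4)[folded T_def] assms(1), of k]
      unfolding error_bound_def Let_def sum.neutral_const by linarith
  qed
  finally show ?thesis using S unfolding T_def by blast
qed


section \<open>Breaker's side\<close>

text \<open>Before Maker's last move all his earlier moves were followed by full turns of Breaker,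
  since a free edge was still left.\<close>

lemma maker_moves_bound:
  assumes legal: "legal_strategy n S" and "h \<in> set_pmf (half_random_play n b S t)"
  shows "length (fst h) \<le> t"
    and "length (fst h) = 0 \<or> (length (fst h) - 1) * (b + 1) < card (board n)"
proof -
  have "length (fst h) \<le> t \<and>
      (length (fst h) = 0 \<or> (length (fst h) - 1) * (b + 1) < card (board n))"
    using assms(2)
  proof (induction t arbitrary: h)
    case (Suc t)
    then obtain h0 where h0: "h0 \<in> set_pmf (half_random_play n b S t)"
      "h \<in> set_pmf (random_breaker_turn n b (maker_turn n S h0))" by auto
    note IH = Suc.IH[OF h0(1)] and fst = random_breaker_turn_support(1)[OF h0(2)]
    show ?case
    proof (cases "free_edges n h0 = {}")
      case True
      then show ?thesis using IH fst by (auto simp: maker_turn_def)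
    next
      case False
      then have "0 < card (free_edges n h0)" by (simp add: card_gt_0_iff)
      then have "t * (b + 1) < card (board n)" using card_free_play[OF legal h0(1)] by simp
      moreover have "length (fst h0) * (b + 1) \<le> t * (b + 1)" using IH by (intro mult_right_mono) auto
      ultimately have "length (fst h0) * (b + 1) < card (board n)" by linarith
      then show ?thesis using IH fst maker_turn_legal(2)[OF legal False] by simp
    qed
  qed simp
  then show "length (fst h) \<le> t"
    and "length (fst h) = 0 \<or> (length (fst h) - 1) * (b + 1) < card (board n)" by auto
qed

text \<open>Each edge covers only two of the \<open>n\<close> vertices. The condition on
  \<open>F\<close> is met by both winning families.\<close>

lemma spanning_needs_many_edges:
  assumes "maker_wins F h"
    and "\<And>W. W \<in> F \<Longrightarrow> W \<subseteq> board n \<and> (\<forall>v<n. \<exists>e\<in>W. v \<in> e)"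
  shows "n \<le> 2 * length (fst h)"
proof -
  obtain W where W: "W \<in> F" "W \<subseteq> set (fst h)" using assms(1) by (auto simp: maker_wins_def)
  note W' = assms(2)[OF W(1)]
  have fin: "finite W" using W(2) finite_subset by blast
  have "{..<n} \<subseteq> \<Union>W" using W' by blast
  moreover have "finite (\<Union>W)"
    using fin W' by (auto simp: board_def intro: finite_subset[of _ "{..<n}"])
  ultimately have "card {..<n} \<le> card (\<Union>W)" by (intro card_mono)
  also have "\<dots> \<le> (\<Sum>e\<in>W. card e)"
    using W' finite_subset[of _ "{..<n}"] by (intro card_Union_le_sum_card_weak) (auto simp: board_def)
  also have "(\<Sum>e\<in>W. card e) = (\<Sum>e\<in>W. 2)"
    using W' by (intro sum.cong) (auto simp: board_def)
  also have "\<dots> = 2 * card W" by simp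
  also have "card W \<le> card (set (fst h))" using W(2) by (intro card_mono) auto
  also have "\<dots> \<le> length (fst h)" by (rule card_length)
  finally show ?thesis by simp
qed

lemma real_card_board: "real (card (board n)) = real n * (real n - 1) / 2"
proof -
  have "even (n * (n - 1))" by (cases n) auto
  then have "real (n * (n - 1) div 2) = real (n * (n - 1)) / 2" by (simp add: real_of_nat_div)
  then show ?thesis by (cases n) (auto simp: card_board algebra_simps)
qed

text \<open>Pure counting: \<open>n / 2\<close> moves of Maker would force
  \<open>(n / 2 - 1) * (1 + \<epsilon>) < (n - 1) / 2\<close>, that is
  \<open>n * \<epsilon> < 1 + 2 * \<epsilon>\<close>. Maker's own edge in each round, the
  \<open>1\<close> in \<open>b + 1\<close>, compensates for rounding the bias down.\<close>

lemma breaker_wins_surely: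
  assumes \<epsilon>: "\<epsilon> > 0" and n: "real n * \<epsilon> \<ge> 2 * (1 + \<epsilon>)" and legal: "legal_strategy n S"
    and F: "\<And>W. W \<in> F \<Longrightarrow> W \<subseteq> board n \<and> (\<forall>v<n. \<exists>e\<in>W. v \<in> e)"
  shows "measure_pmf.prob (half_random_game n (int_bias ((1 + \<epsilon>) * real n)) S)
    {h. \<not> maker_wins F h} = 1"
proof -
  let ?b = "int_bias ((1 + \<epsilon>) * real n)"
  have n0: "real n > 0" using n \<epsilon> by (cases "n = 0") auto
  have b: "(1 + \<epsilon>) * real n < real (?b + 1)"
  proof -
    have "(1 + \<epsilon>) * real n \<ge> 0" using \<epsilon> by simp
    then show ?thesis unfolding int_bias_def by linarith
  qed
  have "\<not> maker_wins F h" if h: "h \<in> set_pmf (half_random_play n ?b S t)" for h t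
  proof
    assume "maker_wins F h"
    then have le: "n \<le> 2 * length (fst h)" using F by (rule spanning_needs_many_edges)
    let ?l = "length (fst h)"
    have l: "?l \<noteq> 0" using le n0 by linarith
    then have "(?l - 1) * (?b + 1) < card (board n)" using maker_moves_bound(2)[OF legal h] by simp
    then have "real ((?l - 1) * (?b + 1)) < real (card (board n))" by (rule of_nat_less_iff[THEN iffD2])
    moreover have "real (?l - 1) = real ?l - 1" using l by (simp add: of_nat_diff Suc_le_eq)
    ultimately have "(real ?l - 1) * real (?b + 1) < real n * (real n - 1) / 2"
      by (simp only: of_nat_mult real_card_board)
    moreover have "(real ?l - 1) * ((1 + \<epsilon>) * real n) \<le> (real ?l - 1) * real (?b + 1)"
      using b l by (intro mult_left_mono) (auto simp: Suc_le_eq)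
    moreover have "real n / 2 \<le> real ?l" using le by linarith
    then have "(real n / 2 - 1) * ((1 + \<epsilon>) * real n) \<le> (real ?l - 1) * ((1 + \<epsilon>) * real n)"
      using \<epsilon> by (intro mult_right_mono) auto
    ultimately have "real n * ((real n / 2 - 1) * (1 + \<epsilon>)) < real n * ((real n - 1) / 2)"
      by (simp add: algebra_simps)
    then have "(real n / 2 - 1) * (1 + \<epsilon>) < (real n - 1) / 2"
      by (simp only: mult_less_cancel_left_pos[OF n0])
    then show False using n by (simp add: algebra_simps)
  qed
  then have "AE h in half_random_game n ?b S. \<not> maker_wins F h"
    by (simp add: half_random_game_def AE_measure_pmf_iff)
  then show ?thesis by (subst measure_pmf.prob_eq_1) auto
qed


section \<open>Choice of the parameters\<close>

text \<open>With \<open>L = ln n\<close>, the choice \<open>\<delta> * c = 3\<close> gives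
  \<open>\<delta> * k \<ge> 3 * L\<close>, so the first exponent
  \<open>2 * k * L - \<delta> * k * k\<close> is at most \<open>- k * L \<le> - L\<close>. In the
  second the linear term dominates \<open>L ^ 2\<close>, and the third summand is of order
  \<open>L / n\<close>.\<close>

lemma error_bound_le:
  fixes c \<delta> :: real
  assumes n: "n \<ge> 3" and k: "c * ln (real n) \<le> real k" "real k \<le> c * ln (real n) + 1" "0 < k"
    and c: "\<delta> * c = 3" and \<delta>: "0 < \<delta>" and b: "b \<le> n" and k13: "13 * k \<le> n"
    and m: "\<delta> / 2 * real n ^ 2 \<le> real m" "m \<le> card (board n)"
  shows "error_bound n k b m \<le> 1 / real n +
    exp ((13 * (c * ln (real n) + 1) + 1) * ln (real n) - \<delta> * (real n - 13 * (c * ln (real n) + 1))) +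
    6 * (c * ln (real n) + 1) * (real n / (\<delta> / 2 * real n ^ 2))"
proof -
  let ?L = "ln (real n)" and ?N = "real (card (board n))"
  define x where "x = 1 - real m / ?N"
  have L: "?L \<ge> 0" using n by simp
  have N: "0 < ?N" "?N \<le> real n ^ 2 / 2"
    using n unfolding real_card_board by (auto simp: power2_eq_square algebra_simps)
  \<comment> \<open>The board has at most \<open>n ^ 2 / 2\<close> edges, so a proportion of at
    least \<open>\<delta>\<close> stays free and
    \<open>x \<le> 1 - \<delta> \<le> exp (- \<delta>)\<close>.\<close>
  have "\<delta> = \<delta> / 2 * real n ^ 2 / (real n ^ 2 / 2)" using n by simp
  also have "\<dots> \<le> real m / ?N" using N m \<delta> by (intro frac_le) auto
  finally have "x \<le> 1 + (- \<delta>)" by (simp add: x_def)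
  also have "\<dots> \<le> exp (- \<delta>)" by (rule exp_ge_add_one_self)
  finally have x1: "x \<le> exp (- \<delta>)" .
  have x0: "0 \<le> x" using m(2) N by (simp add: x_def)
  have pow: "real n ^ i * x ^ j \<le> exp (real i * ?L - \<delta> * real j)" for i j
  proof -
    have "x ^ j \<le> exp (- \<delta>) ^ j" using x0 x1 by (intro power_mono)
    moreover have "real n ^ i = exp ?L ^ i" using n by simp
    ultimately have "real n ^ i * x ^ j \<le> exp ?L ^ i * exp (- \<delta>) ^ j"
      by (simp add: mult_left_mono del: exp_ln)
    also have "\<dots> = exp (real i * ?L - \<delta> * real j)"
      by (simp add: exp_of_nat_mult[symmetric] exp_add[symmetric] algebra_simps del: exp_ln)
    finally show ?thesis .
  qed
  have "3 * ?L \<le> \<delta> * real k" using mult_left_mono[OF k(1), of \<delta>] \<delta> c by (simp flip: mult.assoc)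
  then have "3 * ?L * real k \<le> \<delta> * real k * real k" by (intro mult_right_mono) auto
  moreover have "1 * ?L \<le> real k * ?L" using k(3) L by (intro mult_right_mono) auto
  ultimately have "real (2 * k) * ?L - \<delta> * real (k * k) \<le> - ?L" by (simp add: algebra_simps)
  then have "exp (real (2 * k) * ?L - \<delta> * real (k * k)) \<le> exp (- ?L)" by simp
  also have "\<dots> = 1 / real n" using n by (simp add: exp_minus field_simps)
  finally have 1: "real n ^ (2 * k) * x ^ (k * k) \<le> 1 / real n" using pow[of "2 * k" "k * k"] by linarith
  have "real (13 * k + 1) * ?L \<le> (13 * (c * ?L + 1) + 1) * ?L"
    using L k(2) by (intro mult_right_mono) auto
  moreover have "\<delta> * (real n - 13 * (c * ?L + 1)) \<le> \<delta> * real (n - 13 * k)"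
    using \<delta> k(2) k13 by (intro mult_left_mono) (auto simp: of_nat_diff)
  ultimately have "exp (real (13 * k + 1) * ?L - \<delta> * real (n - 13 * k)) \<le>
      exp ((13 * (c * ?L + 1) + 1) * ?L - \<delta> * (real n - 13 * (c * ?L + 1)))"
    by simp
  then have 2: "real n ^ (13 * k + 1) * x ^ (n - 13 * k) \<le>
      exp ((13 * (c * ?L + 1) + 1) * ?L - \<delta> * (real n - 13 * (c * ?L + 1)))"
    using pow[of "13 * k + 1" "n - 13 * k"] by linarith
  have "0 < \<delta> / 2 * real n ^ 2" using \<delta> n by simp
  then have "real b / real m \<le> real n / (\<delta> / 2 * real n ^ 2)" using b m by (intro frac_le) auto
  then have 3: "6 * real k * (real b / real m) \<le> 6 * (c * ?L + 1) * (real n / (\<delta> / 2 * real n ^ 2))"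
    using k(2) by (intro mult_mono) auto
  show ?thesis using 1 2 3 unfolding error_bound_def Let_def x_def by linarith
qed

lemma parameters_exist:
  fixes \<epsilon> :: real
  assumes \<epsilon>: "\<epsilon> > 0"
  obtains k m :: "nat \<Rightarrow> nat" and g :: "nat \<Rightarrow> real" where
    "(\<lambda>n. real (k n)) \<in> O(\<lambda>n. ln (real n))" "g \<longlonglongrightarrow> 0"
    "\<forall>\<^sub>F n in sequentially. 0 < k n \<and> k n \<le> n div 2 \<and> 13 * k n \<le> n \<and> 0 < m n \<and>
       m n + (n div 2 + 2 * k n) * (int_bias ((1 - \<epsilon>) * real n) + 1) \<le> card (board n) \<and>
       error_bound n (k n) (int_bias ((1 - \<epsilon>) * real n)) (m n) \<le> g n"
proof -
  \<comment> \<open>Capping at \<open>1 / 2\<close> keeps \<open>1 - e\<close> positive; for larger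
    \<open>\<epsilon>\<close> the actual bias is only smaller.\<close>
  define e where "e = min \<epsilon> (1 / 2)"
  define \<delta> where "\<delta> = e / 2"
  define c where "c = 3 / \<delta>"
  have e: "0 < e" "e < 1" "e \<le> \<epsilon>" using \<epsilon> by (auto simp: e_def)
  then have \<delta>: "0 < \<delta>" by (simp add: \<delta>_def)
  then have c: "0 < c" "\<delta> * c = 3" by (auto simp: c_def)
  define k where "k n = nat \<lceil>c * ln (real n)\<rceil>" for n :: nat
  define b where "b n = int_bias ((1 - \<epsilon>) * real n)" for n :: nat
  define m where "m n = card (board n) - (n div 2 + 2 * k n) * (b n + 1)" for n
  define g where "g n = 1 / real n +
    exp ((13 * (c * ln (real n) + 1) + 1) * ln (real n) - \<delta> * (real n - 13 * (c * ln (real n) + 1))) +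
    6 * (c * ln (real n) + 1) * (real n / (\<delta> / 2 * real n ^ 2))" for n :: nat
  have k: "c * ln (real n) \<le> real (k n)" "real (k n) \<le> c * ln (real n) + 1" if "n \<ge> 3" for n
  proof -
    have "0 \<le> c * ln (real n)" using c that by simp
    then show "c * ln (real n) \<le> real (k n)" "real (k n) \<le> c * ln (real n) + 1"
      unfolding k_def by linarith+
  qed
  have b: "real (b n) \<le> (1 - e) * real n" for n
  proof -
    have "(1 - \<epsilon>) * real n \<le> (1 - e) * real n" using e by (intro mult_right_mono) auto
    moreover have "0 \<le> (1 - e) * real n" using e by simp
    ultimately show ?thesis unfolding b_def int_bias_def by linarith
  qed
  have O: "(\<lambda>n. real (k n)) \<in> O(\<lambda>n. ln (real n))"
  proof (rule landau_o.big_trans)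
    show "(\<lambda>n. c * ln (real n) + 1) \<in> O(\<lambda>n. ln (real n))" using c(1) by real_asymp
    show "(\<lambda>n. real (k n)) \<in> O(\<lambda>n. c * ln (real n) + 1)"
    proof (rule landau_o.big_mono)
      show "\<forall>\<^sub>F n in sequentially. norm (real (k n)) \<le> norm (c * ln (real n) + 1)"
        using eventually_ge_at_top[of 3] by eventually_elim (use k(2) in fastforce)
    qed
  qed
  have g: "g \<longlonglongrightarrow> 0" unfolding g_def using c(1) \<delta> by real_asymp
  \<comment> \<open>Against a board of \<open>n * (n - 1) / 2\<close> edges the rounds leave a
    margin of \<open>e / 2 * n ^ 2\<close> up to lower-order terms. These take at most half of it,
    so \<open>e / 4 * n ^ 2 = \<delta> / 2 * n ^ 2\<close> edges stay free.\<close>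
  have "\<forall>\<^sub>F n in sequentially. real n + 2 * (c * ln (real n) + 1) * (real n + 1) \<le> e / 4 * real n ^ 2"
    using e(1) c(1) by real_asymp
  moreover have "\<forall>\<^sub>F n in sequentially. 13 * (c * ln (real n) + 1) \<le> real n"
    using c(1) by real_asymp
  moreover have "\<forall>\<^sub>F n in sequentially. 0 < c * ln (real n)" using c(1) by real_asymp
  ultimately have "\<forall>\<^sub>F n in sequentially. 0 < k n \<and> k n \<le> n div 2 \<and> 13 * k n \<le> n \<and> 0 < m n \<and>
       m n + (n div 2 + 2 * k n) * (b n + 1) \<le> card (board n) \<and> error_bound n (k n) (b n) (m n) \<le> g n"
    using eventually_ge_at_top[of 3]
  proof eventually_elim
    case (elim n)
    note kn = k[OF elim(4)]
    have k0: "0 < k n" using kn(1) elim(3) by linarith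
    have "real (13 * k n) \<le> real n" using kn(2) elim(2) by simp
    then have k13: "13 * k n \<le> n" by (simp only: of_nat_le_iff)
    have "real ((n div 2 + 2 * k n) * (b n + 1)) = real (n div 2 + 2 * k n) * (real (b n) + 1)"
      by (simp add: algebra_simps)
    also have "\<dots> \<le> (real n / 2 + 2 * (c * ln (real n) + 1)) * ((1 - e) * real n + 1)"
    proof (rule mult_mono)
      have "real (n div 2) \<le> real n / 2" by linarith
      then show "real (n div 2 + 2 * k n) \<le> real n / 2 + 2 * (c * ln (real n) + 1)"
        using kn(2) by simp
    qed (use b[of n] elim(3) in auto)
    also have "\<dots> = real n * (real n - 1) / 2 - e / 2 * real n ^ 2 + real n
        + 2 * (c * ln (real n) + 1) * ((1 - e) * real n + 1)"
      by (simp add: power2_eq_square field_simps)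
    also have "2 * (c * ln (real n) + 1) * ((1 - e) * real n + 1) \<le> 2 * (c * ln (real n) + 1) * (real n + 1)"
    proof (rule mult_left_mono)
      show "(1 - e) * real n + 1 \<le> real n + 1" using e by (simp add: algebra_simps)
      show "0 \<le> 2 * (c * ln (real n) + 1)" using c(1) elim(4) by simp
    qed
    finally have T: "e / 4 * real n ^ 2 \<le> real (card (board n)) - real ((n div 2 + 2 * k n) * (b n + 1))"
      using elim(1) real_card_board[of n] by linarith
    have pos: "0 < e / 4 * real n ^ 2" using e elim(4) by simp
    then have "(n div 2 + 2 * k n) * (b n + 1) < card (board n)" using T by linarith
    then have m: "m n + (n div 2 + 2 * k n) * (b n + 1) = card (board n)" "0 < m n"
      by (auto simp: m_def)
    have mlow: "\<delta> / 2 * real n ^ 2 \<le> real (m n)" using T m(1) by (simp add: \<delta>_def flip: m(1))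
    have "(1 - e) * real n \<le> 1 * real n" using e by (intro mult_right_mono) auto
    then have "b n \<le> n" using b[of n] by linarith
    then have "error_bound n (k n) (b n) (m n) \<le> g n"
      unfolding g_def using elim(4) kn k0 c(2) \<delta> k13 mlow m(1) by (intro error_bound_le) auto
    then show ?case using k0 k13 m by auto
  qed
  then show thesis using that[OF O g] unfolding b_def by blast
qed


section \<open>The threshold\<close>

lemma tendsto_prob_1:
  assumes "\<forall>\<^sub>F n in A. measure_pmf.prob (M n) {h. \<not> W n h} \<le> g n" "(g \<longlongrightarrow> 0) A"
  shows "((\<lambda>n. measure_pmf.prob (M n) {h. W n h}) \<longlongrightarrow> 1) A"
proof (rule tendsto_sandwich)
  have "((\<lambda>n. 1 - g n) \<longlongrightarrow> 1 - 0) A" by (intro tendsto_intros assms(2))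
  then show "((\<lambda>n. 1 - g n) \<longlongrightarrow> 1) A" by simp
  show "\<forall>\<^sub>F n in A. 1 - g n \<le> measure_pmf.prob (M n) {h. W n h}"
    using assms(1)
  proof eventually_elim
    case (elim n)
    have "{h. W n h} = UNIV - {h. \<not> W n h}" by auto
    then have "measure_pmf.prob (M n) {h. W n h} = 1 - measure_pmf.prob (M n) {h. \<not> W n h}"
      using measure_pmf.prob_compl[of "{h. \<not> W n h}" "M n"] by simp
    then show ?case using elim by linarith
  qed
qed auto

text \<open>For the exceptional \<open>n\<close>, claiming an arbitrary free edge serves as the
  default strategy.\<close>

lemma choose_strategies:
  assumes "\<forall>\<^sub>F n in A. \<exists>S. legal_strategy n S \<and> Q n S"
  obtains S where "\<forall>n. legal_strategy n (S n)" "\<forall>\<^sub>F n in A. Q n (S n)"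
proof -
  have "\<exists>S. legal_strategy n S" for n
    by (rule exI[of _ "\<lambda>h. SOME e. e \<in> free_edges n h"]) (simp add: legal_strategy_def some_in_eq)
  then have "\<forall>n. \<exists>S. legal_strategy n S \<and> ((\<exists>S. legal_strategy n S \<and> Q n S) \<longrightarrow> Q n S)" by blast
  then obtain S where S: "\<forall>n. legal_strategy n (S n) \<and> ((\<exists>S. legal_strategy n S \<and> Q n S) \<longrightarrow> Q n (S n))"
    by metis
  show thesis
  proof (rule that[of S])
    show "\<forall>\<^sub>F n in A. Q n (S n)" using assms by eventually_elim (use S in blast)
  qed (use S in blast)
qed

lemma tendsto_play_imp_game:
  assumes "((\<lambda>n. measure_pmf.prob (half_random_play n (b n) (S n) (T n)) {h. maker_wins (F n) h}) \<longlongrightarrow> 1) A"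
    and "\<forall>\<^sub>F n in A. T n \<le> card (board n)"
  shows "((\<lambda>n. measure_pmf.prob (half_random_game n (b n) (S n)) {h. maker_wins (F n) h}) \<longlongrightarrow> 1) A"
proof (rule tendsto_sandwich[OF _ _ assms(1) tendsto_const])
  show "\<forall>\<^sub>F n in A. measure_pmf.prob (half_random_play n (b n) (S n) (T n)) {h. maker_wins (F n) h}
      \<le> measure_pmf.prob (half_random_game n (b n) (S n)) {h. maker_wins (F n) h}"
    using assms(2) by eventually_elim
      (unfold half_random_game_def, rule prob_play_mono, auto simp: maker_wins_def)
qed auto

text \<open>Breaker's half follows from counting for every family of spanning graphs along any
  filter below \<open>sequentially\<close>; only Maker's half depends on the game.\<close>

lemma sharp_threshold_biasI:
  assumes A: "A \<le> sequentially"
    and F: "\<And>n W. W \<in> F n \<Longrightarrow> W \<subseteq> board n \<and> (\<forall>v<n. \<exists>e\<in>W. v \<in> e)"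
    and maker: "\<And>\<epsilon>. \<epsilon> > 0 \<Longrightarrow> \<exists>S. (\<forall>n. legal_strategy n (S n)) \<and>
      ((\<lambda>n. measure_pmf.prob (half_random_game n (int_bias ((1 - \<epsilon>) * real n)) (S n))
        {h. maker_wins (F n) h}) \<longlongrightarrow> 1) A"
  shows "sharp_threshold_bias A F (\<lambda>n. n)"
  unfolding sharp_threshold_bias_def
proof (intro allI impI conjI)
  fix \<epsilon> :: real and S :: "nat \<Rightarrow> strategy"
  assume \<epsilon>: "\<epsilon> > 0" and legal: "\<forall>n. legal_strategy n (S n)"
  have "\<forall>\<^sub>F n in sequentially. real n * \<epsilon> \<ge> 2 * (1 + \<epsilon>)" using \<epsilon> by real_asymp
  then have "\<forall>\<^sub>F n in A. real n * \<epsilon> \<ge> 2 * (1 + \<epsilon>)" using A by (rule filter_leD[rotated])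
  then have "\<forall>\<^sub>F n in A. measure_pmf.prob
      (half_random_game n (int_bias ((1 + \<epsilon>) * real n)) (S n)) {h. \<not> maker_wins (F n) h} = 1"
    by eventually_elim (rule breaker_wins_surely, use \<epsilon> legal F in auto)
  then show "((\<lambda>n. measure_pmf.prob (half_random_game n (int_bias ((1 + \<epsilon>) * real n)) (S n))
      {h. \<not> maker_wins (F n) h}) \<longlongrightarrow> 1) A"
    by (rule tendsto_eventually)
qed (rule maker)

lemma even_sequentially_le: "even_sequentially \<le> sequentially"
  by (simp add: even_sequentially_def)

text \<open>The last conclusion says that the fast win happens within the actual game, so the same
  strategies serve for the threshold.\<close>

lemma perfect_matching_fast_win:
  fixes \<epsilon> :: real
  assumes "\<epsilon> > 0"
  obtains S f where "\<forall>n. legal_strategy n (S n)" "f \<in> O(\<lambda>n. ln (real n))"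
    "((\<lambda>n. measure_pmf.prob (half_random_play n (int_bias ((1 - \<epsilon>) * real n)) (S n)
        (nat \<lfloor>real n / 2 + f n\<rfloor>)) {h. maker_wins (perfect_matchings n) h}) \<longlongrightarrow> 1) even_sequentially"
    "\<forall>\<^sub>F n in even_sequentially. nat \<lfloor>real n / 2 + f n\<rfloor> \<le> card (board n)"
proof -
  obtain k m g where O: "(\<lambda>n. real (k n)) \<in> O(\<lambda>n. ln (real n))" and g: "g \<longlonglongrightarrow> 0"
    and ev: "\<forall>\<^sub>F n in sequentially. 0 < k n \<and> k n \<le> n div 2 \<and> 13 * k n \<le> n \<and> 0 < m n \<and>
       m n + (n div 2 + 2 * k n) * (int_bias ((1 - \<epsilon>) * real n) + 1) \<le> card (board n) \<and>
       error_bound n (k n) (int_bias ((1 - \<epsilon>) * real n)) (m n) \<le> g n"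
    by (rule parameters_exist[OF assms])
  define f where "f n = 2 * real (k n)" for n
  define T where "T n = nat \<lfloor>real n / 2 + f n\<rfloor>" for n
  \<comment> \<open>For even \<open>n\<close> the number of rounds is an integer and rounding has no
    effect.\<close>
  have T: "T n = n div 2 + 2 * k n" if "even n" for n
  proof -
    have "real n / 2 + f n = real (n div 2 + 2 * k n)" using that by (simp add: f_def real_of_nat_div)
    then show ?thesis unfolding T_def by (metis floor_of_nat nat_int)
  qed
  have "\<forall>\<^sub>F n in even_sequentially. even n"
    by (simp add: even_sequentially_def eventually_inf_principal)
  moreover note filter_leD[OF even_sequentially_le ev]
  ultimately have ev': "\<forall>\<^sub>F n in even_sequentially. T n \<le> card (board n) \<and>
      (\<exists>S. legal_strategy n S \<and> measure_pmf.prob (half_random_play n (int_bias ((1 - \<epsilon>) * real n)) S (T n))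
        {h. \<not> maker_wins (perfect_matchings n) h} \<le> g n)"
  proof eventually_elim
    case (elim n)
    have "T n * 1 \<le> T n * (int_bias ((1 - \<epsilon>) * real n) + 1)" by (intro mult_left_mono) auto
    also have "\<dots> \<le> card (board n)"
      using elim(2) unfolding T[OF elim(1)] by (blast dest: add_leD2)
    finally have "T n \<le> card (board n)" by simp
    moreover have "\<exists>S. legal_strategy n S \<and>
        measure_pmf.prob (half_random_play n (int_bias ((1 - \<epsilon>) * real n)) S (T n))
          {h. \<not> maker_wins (perfect_matchings n) h}
        \<le> error_bound n (k n) (int_bias ((1 - \<epsilon>) * real n)) (m n)"
      unfolding T[OF elim(1)] using elim by (intro perfect_matching_strategy) auto
    ultimately show ?case using elim(2) by (meson order_trans)
  qed
  then have "\<forall>\<^sub>F n in even_sequentially. \<exists>S. legal_strategy n S \<and>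
      measure_pmf.prob (half_random_play n (int_bias ((1 - \<epsilon>) * real n)) S (T n))
        {h. \<not> maker_wins (perfect_matchings n) h} \<le> g n"
    by eventually_elim blast
  then obtain S where S: "\<forall>n. legal_strategy n (S n)"
    and le: "\<forall>\<^sub>F n in even_sequentially.
      measure_pmf.prob (half_random_play n (int_bias ((1 - \<epsilon>) * real n)) (S n) (T n))
        {h. \<not> maker_wins (perfect_matchings n) h} \<le> g n"
    by (rule choose_strategies)
  show thesis
  proof (rule that[OF S, of f])
    show "f \<in> O(\<lambda>n. ln (real n))" unfolding f_def[abs_def] using O by simp
    show "((\<lambda>n. measure_pmf.prob (half_random_play n (int_bias ((1 - \<epsilon>) * real n)) (S n)
        (nat \<lfloor>real n / 2 + f n\<rfloor>)) {h. maker_wins (perfect_matchings n) h}) \<longlongrightarrow> 1) even_sequentially"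
      using tendsto_prob_1[OF le tendsto_mono[OF even_sequentially_le g]] by (simp only: T_def)
    show "\<forall>\<^sub>F n in even_sequentially. nat \<lfloor>real n / 2 + f n\<rfloor> \<le> card (board n)"
      using ev' by eventually_elim (simp add: T_def)
  qed
qed

lemma min_degree_win:
  fixes \<epsilon> :: real
  assumes "\<epsilon> > 0"
  shows "\<exists>S. (\<forall>n. legal_strategy n (S n)) \<and>
    ((\<lambda>n. measure_pmf.prob (half_random_game n (int_bias ((1 - \<epsilon>) * real n)) (S n))
      {h. maker_wins (min_degree_one_graphs n) h}) \<longlongrightarrow> 1) sequentially"
proof -
  obtain k m g where "(\<lambda>n. real (k n)) \<in> O(\<lambda>n. ln (real n))" and g: "g \<longlonglongrightarrow> 0"
    and ev: "\<forall>\<^sub>F n in sequentially. 0 < k n \<and> k n \<le> n div 2 \<and> 13 * k n \<le> n \<and> 0 < m n \<and>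
       m n + (n div 2 + 2 * k n) * (int_bias ((1 - \<epsilon>) * real n) + 1) \<le> card (board n) \<and>
       error_bound n (k n) (int_bias ((1 - \<epsilon>) * real n)) (m n) \<le> g n"
    by (rule parameters_exist[OF assms])
  define T where "T n = n div 2 + 2 * k n" for n
  have ev': "\<forall>\<^sub>F n in sequentially. T n \<le> card (board n) \<and>
      (\<exists>S. legal_strategy n S \<and> measure_pmf.prob (half_random_play n (int_bias ((1 - \<epsilon>) * real n)) S (T n))
        {h. \<not> maker_wins (min_degree_one_graphs n) h} \<le> g n)"
    using ev
  proof eventually_elim
    case (elim n)
    have "T n * 1 \<le> T n * (int_bias ((1 - \<epsilon>) * real n) + 1)" by (intro mult_left_mono) auto
    also have "\<dots> \<le> card (board n)" using elim unfolding T_def by (blast dest: add_leD2)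
    finally have "T n \<le> card (board n)" by simp
    moreover have "\<exists>S. legal_strategy n S \<and>
        measure_pmf.prob (half_random_play n (int_bias ((1 - \<epsilon>) * real n)) S (T n))
          {h. \<not> maker_wins (min_degree_one_graphs n) h}
        \<le> error_bound n (k n) (int_bias ((1 - \<epsilon>) * real n)) (m n)"
      unfolding T_def using elim by (intro min_degree_strategy) auto
    ultimately show ?case using elim by (meson order_trans)
  qed
  then have "\<forall>\<^sub>F n in sequentially. \<exists>S. legal_strategy n S \<and>
      measure_pmf.prob (half_random_play n (int_bias ((1 - \<epsilon>) * real n)) S (T n))
        {h. \<not> maker_wins (min_degree_one_graphs n) h} \<le> g n"
    by eventually_elim blast
  then obtain S where S: "\<forall>n. legal_strategy n (S n)"
    and le: "\<forall>\<^sub>F n in sequentially.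
      measure_pmf.prob (half_random_play n (int_bias ((1 - \<epsilon>) * real n)) (S n) (T n))
        {h. \<not> maker_wins (min_degree_one_graphs n) h} \<le> g n"
    by (rule choose_strategies)
  have "\<forall>\<^sub>F n in sequentially. T n \<le> card (board n)" using ev' by eventually_elim simp
  with tendsto_prob_1[OF le g]
  have "((\<lambda>n. measure_pmf.prob (half_random_game n (int_bias ((1 - \<epsilon>) * real n)) (S n))
      {h. maker_wins (min_degree_one_graphs n) h}) \<longlonglongrightarrow> 1)"
    by (rule tendsto_play_imp_game)
  with S show ?thesis by blast
qed

theorem theorem1:
  shows "(\<forall>\<epsilon>::real. \<epsilon> > 0 \<longrightarrow>
           (\<exists>(S :: nat \<Rightarrow> strategy) (f :: nat \<Rightarrow> real).
              (\<forall>n. legal_strategy n (S n)) \<and>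
              f \<in> O(\<lambda>n. ln (real n)) \<and>
              ((\<lambda>n. measure_pmf.prob
                       (half_random_play n (int_bias ((1 - \<epsilon>) * real n)) (S n)
                          (nat \<lfloor>real n / 2 + f n\<rfloor>))
                       {h. maker_wins (perfect_matchings n) h}) \<longlongrightarrow> 1) even_sequentially)) \<and>
         sharp_threshold_bias even_sequentially perfect_matchings (\<lambda>n. n) \<and>
         sharp_threshold_bias sequentially min_degree_one_graphs (\<lambda>n. n)"
proof (intro conjI allI impI)
  fix \<epsilon> :: real assume "\<epsilon> > 0"
  then show "\<exists>(S :: nat \<Rightarrow> strategy) (f :: nat \<Rightarrow> real).
      (\<forall>n. legal_strategy n (S n)) \<and> f \<in> O(\<lambda>n. ln (real n)) \<and>
      ((\<lambda>n. measure_pmf.prob (half_random_play n (int_bias ((1 - \<epsilon>) * real n)) (S n)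
        (nat \<lfloor>real n / 2 + f n\<rfloor>)) {h. maker_wins (perfect_matchings n) h}) \<longlongrightarrow> 1) even_sequentially"
    by (rule perfect_matching_fast_win) blast
next
  show "sharp_threshold_bias even_sequentially perfect_matchings (\<lambda>n. n)"
  proof (rule sharp_threshold_biasI[OF even_sequentially_le])
    fix \<epsilon> :: real assume "\<epsilon> > 0"
    then show "\<exists>S. (\<forall>n. legal_strategy n (S n)) \<and>
      ((\<lambda>n. measure_pmf.prob (half_random_game n (int_bias ((1 - \<epsilon>) * real n)) (S n))
        {h. maker_wins (perfect_matchings n) h}) \<longlongrightarrow> 1) even_sequentially"
    proof (rule perfect_matching_fast_win)
      fix S and f :: "nat \<Rightarrow> real"
      assume S: "\<forall>n. legal_strategy n (S n)"
        and lim: "((\<lambda>n. measure_pmf.prob (half_random_play n (int_bias ((1 - \<epsilon>) * real n)) (S n)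
          (nat \<lfloor>real n / 2 + f n\<rfloor>)) {h. maker_wins (perfect_matchings n) h}) \<longlongrightarrow> 1) even_sequentially"
        and T: "\<forall>\<^sub>F n in even_sequentially. nat \<lfloor>real n / 2 + f n\<rfloor> \<le> card (board n)"
      from tendsto_play_imp_game[OF lim T] S show ?thesis by blast
    qed
  qed (auto simp: perfect_matchings_def)
next
  show "sharp_threshold_bias sequentially min_degree_one_graphs (\<lambda>n. n)"
  proof (rule sharp_threshold_biasI[OF order_refl _ min_degree_win])
    fix n W assume W: "W \<in> min_degree_one_graphs n"
    have "\<exists>e\<in>W. v \<in> e" if "v < n" for v
    proof -
      have "0 < card {e \<in> W. v \<in> e}"
        using W that by (auto simp: min_degree_one_graphs_def vertex_degree_def Suc_le_eq)
      then show ?thesis by (auto simp: card_gt_0_iff)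
    qed
    then show "W \<subseteq> board n \<and> (\<forall>v<n. \<exists>e\<in>W. v \<in> e)" using W by (auto simp: min_degree_one_graphs_def)
  qed
qed

end
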